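(* Let $G=(V,E)$ be a directed graph with cemetery vertex $\delta$, $U=V\setminus\{\delta\}$ and base point $x_0\in U$, satisfying the standing assumptions of the context, and let $(\alpha_e)_{e\in E}$ be (not necessarily positive) real weights such that the integrals $I_{\Delta,T}(\lambda)=I^{(\alpha)}_{\Delta,T}(\lambda)$ are well-defined, for all spanning trees $T$ and all $\lambda\in\mathbb{C}^E$ with $\Re(\lambda_e)>0$ for all $e\in E$. Let $\mathcal{T}$ be the set of spanning trees of $G$. Then the vector $I_\Delta(\lambda)=(I_{\Delta,T}(\lambda))_{T\in\mathcal{T}}$ satisfies $$ d I_\Delta(\lambda)=-\Omega\, I_\Delta(\lambda)\qquad\text{on } M\cap\{\lambda:\ \Re(\lambda_e)>0\ \forall e\in E\}, $$ where $d$ is the differential operator in the variables $\lambda$, and $\Omega$ is the $\mathcal{T}\times\mathcal{T}$ matrix with differential form coefficients $$ \Omega=\sum_\sigma dl_\sigma(\lambda)\,\Omega_\sigma+\sum_C\frac{dl_C(\lambda)}{l_C(\lambda)}\,\Omega_C, $$ the first sum being over all simple paths $\sigma$ from $x_0$ to $\delta$ and the second over all simple cycles $C$ of $G$. Here the matrix entry $(\Omega_C)_{T,T'}$ is the coefficient of $f_{T'}$ in $\Omega_C(f_T)$ (and likewise for the diagonal $\Omega_\sigma$), so that the equation reads $dI_{\Delta,T}=-\sum_{T'\in\mathcal{T}}\Omega_{T,T'}I_{\Delta,T'}$ for every $T\in\mathcal{T}$.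
   Context: **Graph.** $G=(V,E)$ is a finite directed graph, $E\subset V\times V$, without loops (no edges $(x,x)$). For $e\in E$, $\underline e$ is its origin and $\overline e$ its destination, $e=(\underline e,\overline e)$. One has $V=U\sqcup\{\delta\}$ and a base point $x_0\in U$ such that: no edge has origin $\delta$; for every $x\in U$ there is a directed simple path from $x$ to $\delta$; for every $x\in U$ there is a directed simple path from $x_0$ to $x$. **Paths, cycles, trees.** A simple path from $x$ to $y$ ($x\ne y$) is a set of edges $\{e_1,\dots,e_k\}$ for which there are distinct vertices $x_0'=x,x_1',\dots,x_k'=y$ with $e_j=(x_{j-1}',x_j')$ or $e_j=(x_j',x_{j-1}')$ for each $j$; it is directed if $e_j=(x'_{j-1},x'_j)$ for all $j$. A (simple) cycle is a set of distinct edges $\{e_1,\dots,e_k\}$ ($k\ge2$) for which there are distinct vertices $x_0',\dots,x_{k-1}'$ (with $x_k'=x_0'$) such that $e_j=(x'_{j-1},x'_j)$ or $e_j=(x'_j,x'_{j-1})$ for each $j$. A spanning tree is a subset $T\subset E$ containing no cycle and containing a simple path between any two vertices. $T^c=E\setminus T$. (Paths, cycles and spanning trees need not be directed.) **Integrals.** For $\theta\in\mathbb{R}^E$ and $x\in U$, $\mathrm{div}(\theta)(x)=\sum_{\underline e=x}\theta_e-\sum_{\overline e=x}\theta_e$. Let $\mathcal{H}^{G,x_0}=\{z\in\mathbb{R}^E:\ \mathrm{div}(z)=\delta_{x_0}\}$ ($\delta_{x_0}$ is the Dirac mass at $x_0$), an affine space of dimension $n=|E|-|U|$ endowed with an arbitrary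 fixed orientation, and $\Delta=\{z\in\mathcal{H}^{G,x_0}:\ z_e>0\ \forall e\in E\}$. For a spanning tree $T$, $\omega_T=\frac{dz_{e_1}}{z_{e_1}}\wedge\dots\wedge\frac{dz_{e_n}}{z_{e_n}}$ with $\{e_1,\dots,e_n\}=T^c$ ordered so that $\omega_T$ is positively oriented on $\Delta$. For $\lambda\in\mathbb{C}^E$ with $\Re(\lambda_e)>0$ for all $e$, $$I^{(\alpha)}_{\Delta,T}(\lambda)=\int_\Delta e^{-\langle\lambda,z\rangle}\prod_{e\in E}z_e^{\alpha_e}\ \omega_T,\qquad \langle\lambda,z\rangle=\sum_{e\in E}\lambda_e z_e .$$ **Linear forms.** For a cycle $C$ with an arbitrary orientation, $l_C(\lambda)=\sum_{e\in C}\epsilon_C(e)\lambda_e$, with $\epsilon_C(e)=+1$ (resp. $-1$) if $e$ is directed according to (resp. in opposition to) the orientation of $C$. For a simple path $\sigma$ from $x_0$ to $\delta$, $l_\sigma(\lambda)=\sum_{e\in\sigma}\epsilon_\sigma(e)\lambda_e$, with $\epsilon_\sigma(e)=+1$ (resp. $-1$) if $e$ is directed from $x_0$ to $\delta$ (resp. from $\delta$ to $x_0$) along $\sigma$. These are extended linearly to $\mathbb{C}^E$, and $M=\mathbb{C}^E\setminus\bigcup_{C\text{ cycle}}\ker l_C$. The form $dl_C/l_C$ does not depend on the orientation of $C$. **Endomorphisms.** $(f_T)_{T\in\mathcal{T}}$ is the canonical basis of $\mathbb{R}^{\mathcal{T}}$. For a simple cycle $C$, the endomorphism $\Omega_C$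 of $\mathbb{R}^{\mathcal{T}}$ is given by $$\Omega_C(f_T)=\sum_{e\in C}\epsilon_C(e_0,e)\,\alpha_e\,f_{T\cup\{e_0\}\setminus\{e\}}$$ if there is an edge $e_0\in T^c$ such that $C\subset T\cup\{e_0\}$, and $\Omega_C(f_T)=0$ otherwise; here $\epsilon_C(e_0,e)=+1$ (resp. $-1$) if the directions of $e_0$ and $e$ in the cycle $C$ are the same (resp. opposite). For a simple path $\sigma$ from $x_0$ to $\delta$, $\Omega_\sigma$ is the diagonal endomorphism of $\mathbb{R}^{\mathcal{T}}$ with $(\Omega_\sigma)_{T,T}=1$ if $\sigma\subset T$ and $0$ otherwise. *)

theory Defs
  imports "HOL-Analysis.Analysis" "Graph_Theory.Digraph"
begin

section \<open>Paths, cycles and spanning trees\<close>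

text \<open>
  Paths and cycles are sets of edges that may be traversed against their direction, unlike the
  arc walks of the graph library. They are presented by a list \<open>xs\<close> of vertices and a
  list \<open>es\<close> of edges.
\<close>

definition traverses :: "('v, 'e) pre_digraph \<Rightarrow> 'v \<Rightarrow> 'e \<Rightarrow> 'v \<Rightarrow> bool" where
  "traverses G x e y \<longleftrightarrow> e \<in> arcs G \<and> tail G e = x \<and> head G e = y"

definition path_seq :: "('v, 'e) pre_digraph \<Rightarrow> 'v \<Rightarrow> 'v \<Rightarrow> 'v list \<Rightarrow> 'e list \<Rightarrow> bool" where
  "path_seq G x y xs es \<longleftrightarrow>
     x \<noteq> y \<and> length xs = Suc (length es) \<and> distinct xs \<and> hd xs = x \<and> last xs = y \<and>
     (\<forall>j<length es. traverses G (xs ! j) (es ! j) (xs ! Suc j) \<or>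
                    traverses G (xs ! Suc j) (es ! j) (xs ! j))"

definition simple_path :: "('v, 'e) pre_digraph \<Rightarrow> 'v \<Rightarrow> 'v \<Rightarrow> 'e set \<Rightarrow> bool" where
  "simple_path G x y \<sigma> \<longleftrightarrow> (\<exists>xs es. path_seq G x y xs es \<and> \<sigma> = set es)"

definition directed_simple_path :: "('v, 'e) pre_digraph \<Rightarrow> 'v \<Rightarrow> 'v \<Rightarrow> 'e set \<Rightarrow> bool" where
  "directed_simple_path G x y \<sigma> \<longleftrightarrow>
     (\<exists>xs es. path_seq G x y xs es \<and> \<sigma> = set es \<and>
        (\<forall>j<length es. traverses G (xs ! j) (es ! j) (xs ! Suc j)))"

text \<open>The set of edges of a path determines the lists presenting it, hence the signs below.\<close>

definition path_sign :: "('v, 'e) pre_digraph \<Rightarrow> 'v \<Rightarrow> 'v \<Rightarrow> 'e set \<Rightarrow> 'e \<Rightarrow> real" where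
  "path_sign G x y \<sigma> e =
     (if \<exists>xs es. path_seq G x y xs es \<and> \<sigma> = set es \<and>
           (\<exists>j<length es. es ! j = e \<and> traverses G (xs ! j) e (xs ! Suc j))
      then 1 else - 1)"

text \<open>
  Since the edges are required to be distinct, a cycle of length 2 consists of two antiparallel
  edges.
\<close>

definition cycle_seq :: "('v, 'e) pre_digraph \<Rightarrow> 'v list \<Rightarrow> 'e list \<Rightarrow> bool" where
  "cycle_seq G xs es \<longleftrightarrow>
     2 \<le> length es \<and> length xs = length es \<and> distinct xs \<and> distinct es \<and>
     (\<forall>j<length es. traverses G (xs ! j) (es ! j) (xs ! (Suc j mod length es)) \<or>
                    traverses G (xs ! (Suc j mod length es)) (es ! j) (xs ! j))"

definition simple_cycle :: "('v, 'e) pre_digraph \<Rightarrow> 'e set \<Rightarrow> bool" where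
  "simple_cycle G C \<longleftrightarrow> (\<exists>xs es. cycle_seq G xs es \<and> C = set es)"

text \<open>
  \<open>cycle_orientation G C s\<close>: the function \<open>s\<close> gives, on \<open>C\<close>, the signs of the edges with respect
  to one of the two orientations of \<open>C\<close>.
\<close>

definition cycle_orientation :: "('v, 'e) pre_digraph \<Rightarrow> 'e set \<Rightarrow> ('e \<Rightarrow> real) \<Rightarrow> bool" where
  "cycle_orientation G C s \<longleftrightarrow>
     (\<exists>xs es. cycle_seq G xs es \<and> C = set es \<and>
        (\<forall>j<length es. s (es ! j) =
           (if traverses G (xs ! j) (es ! j) (xs ! (Suc j mod length es)) then 1 else - 1)))"

definition spanning_trees :: "('v, 'e) pre_digraph \<Rightarrow> 'e set set" where
  "spanning_trees G =
     {T. T \<subseteq> arcs G \<and> (\<forall>C. simple_cycle G C \<longrightarrow> \<not> C \<subseteq> T) \<and>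
         (\<forall>x\<in>verts G. \<forall>y\<in>verts G. x \<noteq> y \<longrightarrow> (\<exists>\<sigma>. simple_path G x y \<sigma> \<and> \<sigma> \<subseteq> T))}"

text \<open>
  The edges are the elements of a finite type, so that the coordinate spaces indexed by edges
  are the types \<open>real ^ 'e\<close> and \<open>complex ^ 'e\<close>; the locale \<open>digraph\<close> makes an edge
  determined by the pair of its origin \<open>tail G e\<close> and its destination \<open>head G e\<close>.
\<close>

locale cemetery_digraph = digraph G
  for G :: "('v, 'e::finite) pre_digraph" (structure) +
  fixes \<delta> x\<^sub>0 :: 'v
  assumes arcs_UNIV: "arcs G = UNIV"
    and cemetery_in_verts: "\<delta> \<in> verts G"
    and base_in_verts: "x\<^sub>0 \<in> verts G - {\<delta>}"
    and no_edge_from_cemetery: "e \<in> arcs G \<Longrightarrow> tail G e \<noteq> \<delta>"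
    and path_to_cemetery:
      "x \<in> verts G - {\<delta>} \<Longrightarrow> \<exists>\<sigma>. directed_simple_path G x \<delta> \<sigma>"
    and path_from_base:
      "x \<in> verts G - {\<delta>} \<Longrightarrow> x \<noteq> x\<^sub>0 \<Longrightarrow> \<exists>\<sigma>. directed_simple_path G x\<^sub>0 x \<sigma>"

section \<open>The integrals\<close>

definition divergence :: "('v, 'e::finite) pre_digraph \<Rightarrow> real ^ 'e \<Rightarrow> 'v \<Rightarrow> real" where
  "divergence G \<theta> x =
     (\<Sum>e\<in>{e \<in> arcs G. tail G e = x}. \<theta> $ e) - (\<Sum>e\<in>{e \<in> arcs G. head G e = x}. \<theta> $ e)"

definition unit_flows :: "('v, 'e::finite) pre_digraph \<Rightarrow> 'v \<Rightarrow> 'v \<Rightarrow> (real ^ 'e) set" where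
  "unit_flows G \<delta> x\<^sub>0 =
     {z. \<forall>x\<in>verts G - {\<delta>}. divergence G z x = (if x = x\<^sub>0 then 1 else 0)}"

definition positive_flows :: "('v, 'e::finite) pre_digraph \<Rightarrow> 'v \<Rightarrow> 'v \<Rightarrow> (real ^ 'e) set" where
  "positive_flows G \<delta> x\<^sub>0 = {z \<in> unit_flows G \<delta> x\<^sub>0. \<forall>e\<in>arcs G. z $ e > 0}"

definition tree_chart ::
    "('v, 'e::finite) pre_digraph \<Rightarrow> 'e set \<Rightarrow> real ^ 'e \<Rightarrow> ('e \<Rightarrow> real)" where
  "tree_chart G T z = (\<lambda>e\<in>arcs G - T. z $ e)"

definition pairing :: "('v, 'e::finite) pre_digraph \<Rightarrow> complex ^ 'e \<Rightarrow> real ^ 'e \<Rightarrow> complex" where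
  "pairing G lam z = (\<Sum>e\<in>arcs G. lam $ e * of_real (z $ e))"

text \<open>
  For a spanning tree \<open>T\<close>, the coordinates outside \<open>T\<close> form a global affine chart of
  \<open>unit_flows\<close>. In this chart the form \<open>\<omega>\<^sub>T\<close>, positively oriented, is Lebesgue measure multiplied
  by the inverses of the coordinates, so the integral of a multiple of \<open>\<omega>\<^sub>T\<close> over
  \<open>positive_flows\<close> is a Lebesgue integral over the image of the chart. For a graph which is itself
  a tree, this is the value of the function at the only point.
\<close>

definition tree_integrand ::
    "('v, 'e::finite) pre_digraph \<Rightarrow> ('e \<Rightarrow> real) \<Rightarrow> 'e set \<Rightarrow> complex ^ 'e \<Rightarrow> real ^ 'e \<Rightarrow> complex" where
  "tree_integrand G \<alpha> T lam z =
     exp (- pairing G lam z) * of_real (\<Prod>e\<in>arcs G. (z $ e) powr \<alpha> e) *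
     of_real (\<Prod>e\<in>arcs G - T. 1 / z $ e)"

definition tree_integral_exists ::
    "('v, 'e::finite) pre_digraph \<Rightarrow> 'v \<Rightarrow> 'v \<Rightarrow> ('e \<Rightarrow> real) \<Rightarrow> 'e set \<Rightarrow> complex ^ 'e \<Rightarrow> bool" where
  "tree_integral_exists G \<delta> x\<^sub>0 \<alpha> T lam \<longleftrightarrow>
     set_integrable (Pi\<^sub>M (arcs G - T) (\<lambda>_. lborel)) (tree_chart G T ` positive_flows G \<delta> x\<^sub>0)
       (\<lambda>y. tree_integrand G \<alpha> T lam (inv_into (positive_flows G \<delta> x\<^sub>0) (tree_chart G T) y))"

definition tree_integral ::
    "('v, 'e::finite) pre_digraph \<Rightarrow> 'v \<Rightarrow> 'v \<Rightarrow> ('e \<Rightarrow> real) \<Rightarrow> 'e set \<Rightarrow> complex ^ 'e \<Rightarrow> complex" where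
  "tree_integral G \<delta> x\<^sub>0 \<alpha> T lam =
     set_lebesgue_integral (Pi\<^sub>M (arcs G - T) (\<lambda>_. lborel)) (tree_chart G T ` positive_flows G \<delta> x\<^sub>0)
       (\<lambda>y. tree_integrand G \<alpha> T lam (inv_into (positive_flows G \<delta> x\<^sub>0) (tree_chart G T) y))"

section \<open>The connection matrix\<close>

definition signed_form :: "('e \<Rightarrow> real) \<Rightarrow> 'e set \<Rightarrow> complex ^ 'e \<Rightarrow> complex" where
  "signed_form s A lam = (\<Sum>e\<in>A. of_real (s e) * lam $ e)"

text \<open>
  In the following, \<open>\<epsilon> C\<close> is the sign function of the orientation chosen for the cycle \<open>C\<close>.
\<close>

definition cycle_form :: "('e set \<Rightarrow> 'e \<Rightarrow> real) \<Rightarrow> 'e set \<Rightarrow> complex ^ 'e \<Rightarrow> complex" where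
  "cycle_form \<epsilon> C = signed_form (\<epsilon> C) C"

definition path_form ::
    "('v, 'e) pre_digraph \<Rightarrow> 'v \<Rightarrow> 'v \<Rightarrow> 'e set \<Rightarrow> complex ^ 'e \<Rightarrow> complex" where
  "path_form G \<delta> x\<^sub>0 \<sigma> = signed_form (path_sign G x\<^sub>0 \<delta> \<sigma>) \<sigma>"

definition regular_points ::
    "('v, 'e) pre_digraph \<Rightarrow> ('e set \<Rightarrow> 'e \<Rightarrow> real) \<Rightarrow> (complex ^ 'e) set" where
  "regular_points G \<epsilon> = UNIV - (\<Union>C\<in>{C. simple_cycle G C}. {lam. cycle_form \<epsilon> C lam = 0})"

text \<open>Vectors indexed by spanning trees are written as functions on sets of edges.\<close>

definition tree_basis :: "'e set \<Rightarrow> 'e set \<Rightarrow> real" where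
  "tree_basis T = (\<lambda>T'. if T' = T then 1 else 0)"

text \<open>\<open>cycle_endo_basis G \<alpha> \<epsilon> C T\<close> is the image of the basis vector of \<open>T\<close> under \<open>\<Omega>\<^sub>C\<close>.\<close>

definition cycle_endo_basis ::
    "('v, 'e) pre_digraph \<Rightarrow> ('e \<Rightarrow> real) \<Rightarrow> ('e set \<Rightarrow> 'e \<Rightarrow> real) \<Rightarrow> 'e set \<Rightarrow> 'e set \<Rightarrow>
     'e set \<Rightarrow> real" where
  "cycle_endo_basis G \<alpha> \<epsilon> C T =
     (if \<exists>e\<^sub>0\<in>arcs G - T. C \<subseteq> T \<union> {e\<^sub>0}
      then let e\<^sub>0 = (THE e\<^sub>0. e\<^sub>0 \<in> arcs G - T \<and> C \<subseteq> T \<union> {e\<^sub>0})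
           in (\<lambda>T'. \<Sum>e\<in>C. (if \<epsilon> C e\<^sub>0 = \<epsilon> C e then 1 else - 1) * \<alpha> e *
                            tree_basis ((T \<union> {e\<^sub>0}) - {e}) T')
      else (\<lambda>T'. 0))"

definition cycle_matrix ::
    "('v, 'e) pre_digraph \<Rightarrow> ('e \<Rightarrow> real) \<Rightarrow> ('e set \<Rightarrow> 'e \<Rightarrow> real) \<Rightarrow> 'e set \<Rightarrow>
     'e set \<Rightarrow> 'e set \<Rightarrow> real" where
  "cycle_matrix G \<alpha> \<epsilon> C T T' = cycle_endo_basis G \<alpha> \<epsilon> C T T'"

definition path_matrix :: "'e set \<Rightarrow> 'e set \<Rightarrow> 'e set \<Rightarrow> real" where
  "path_matrix \<sigma> T T' = (if T = T' \<and> \<sigma> \<subseteq> T then 1 else 0)"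

text \<open>
  The entries of \<open>\<Omega>\<close> are differential forms; the last argument \<open>h\<close> is the tangent vector
  at \<open>lam\<close> on which the form is evaluated.
\<close>

definition connection_form ::
    "('v, 'e::finite) pre_digraph \<Rightarrow> 'v \<Rightarrow> 'v \<Rightarrow> ('e \<Rightarrow> real) \<Rightarrow> ('e set \<Rightarrow> 'e \<Rightarrow> real) \<Rightarrow>
     'e set \<Rightarrow> 'e set \<Rightarrow> complex ^ 'e \<Rightarrow> complex ^ 'e \<Rightarrow> complex" where
  "connection_form G \<delta> x\<^sub>0 \<alpha> \<epsilon> T T' lam h =
     (\<Sum>\<sigma>\<in>{\<sigma>. simple_path G x\<^sub>0 \<delta> \<sigma>}.
        frechet_derivative (path_form G \<delta> x\<^sub>0 \<sigma>) (at lam) h * of_real (path_matrix \<sigma> T T')) +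
     (\<Sum>C\<in>{C. simple_cycle G C}.
        frechet_derivative (cycle_form \<epsilon> C) (at lam) h / cycle_form \<epsilon> C lam *
        of_real (cycle_matrix G \<alpha> \<epsilon> C T T'))"

end

theory Submission
  imports Defs "HOL-Number_Theory.Cong"
begin

text \<open>
  Differentiating under the integral multiplies the integrand by \<open>- pairing G h z\<close>. A unit flow \<open>z\<close>
  is the flow of the path from \<open>x\<^sub>0\<close> to \<open>\<delta>\<close> in \<open>T\<close> plus the sum over \<open>e \<notin> T\<close> of \<open>z\<^sub>e\<close> times the flow
  of the fundamental cycle of \<open>e\<close>. The path contributes the first sum in \<open>\<Omega>\<close>. For a cycle \<open>C\<close>
  through \<open>e\<^sub>0 \<notin> T\<close>, the factor \<open>z\<^sub>e\<^sub>0\<close> cancels \<open>1 / z\<^sub>e\<^sub>0\<close> in \<open>\<omega>\<^sub>T\<close>, and integrating the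
  derivative of the resulting function along \<open>C\<close> yields \<open>l\<^sub>C\<close> times the wanted integral as a
  combination of the integrals for the exchanged trees, whose forms agree up to the factors \<open>1 / z\<^sub>e\<close>.
  No boundary terms arise: at an end point of a line in the direction of \<open>C\<close> some \<open>z\<^sub>e\<close> with \<open>e \<in> C\<close>
  vanishes, and the integrability for the exchanged tree forces the function to tend to \<open>0\<close> there.
\<close>

section \<open>Flows of paths and cycles\<close>

text \<open>The weights \<alpha> may have any sign, so neither convergence nor boundary behaviour
  can be read off from the integrand: all analysis is extracted from the assumed integrability. That
  it holds for every admissible \<open>lam\<close> leaves an exponential margin, since the real
  parts can be lowered a little; this gives the moments and the derivative. That it holds for every
  tree controls the boundary, because \<open>1 / (t - k)\<close> is not integrable at
  \<open>k\<close>. Orientations of forms are avoided by carrying the Lebesgue measure of each chart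
  over to the space of flows, where an exchange of edges does not change it, the entries of cycle
  flows being 0 or \<plusminus>1. On the combinatorial side all uniqueness comes from one fact: a
  flow supported on a tree and without divergence off \<delta> is 0. It determines cycles, tree
  paths with their signs, and charts.\<close>

definition signed_vec :: "('e::finite \<Rightarrow> real) \<Rightarrow> 'e set \<Rightarrow> real ^ 'e" where
  "signed_vec s A = (\<chi> e. if e \<in> A then s e else 0)"

lemma signed_vec_nth [simp]: "signed_vec s A $ e = (if e \<in> A then s e else 0)"
  by (simp add: signed_vec_def)

lemma divergence_add: "divergence G (z + w) x = divergence G z x + divergence G w x"
  by (simp add: divergence_def sum.distrib)

lemma divergence_scaleR: "divergence G (c *\<^sub>R z) x = c * divergence G z x"
  by (simp add: divergence_def sum_distrib_left right_diff_distrib)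

lemma divergence_zero [simp]: "divergence G 0 x = 0"
  by (simp add: divergence_def)

lemma divergence_diff: "divergence G (z - w) x = divergence G z x - divergence G w x"
  using divergence_add[of G z "- w" x] divergence_scaleR[of G "-1" w x] by simp

lemma divergence_sum: "divergence G (\<Sum>i\<in>I. f i) x = (\<Sum>i\<in>I. divergence G (f i) x)"
  by (induction I rule: infinite_finite_induct) (auto simp: divergence_add)

lemma pairing_add: "pairing G lam (z + w) = pairing G lam z + pairing G lam w"
  by (simp add: pairing_def sum.distrib algebra_simps)

lemma pairing_scaleR: "pairing G lam (c *\<^sub>R z) = of_real c * pairing G lam z"
  by (simp add: pairing_def sum_distrib_left mult_ac)

lemma pairing_zero [simp]: "pairing G lam 0 = 0"
  by (simp add: pairing_def)

lemma pairing_sum: "pairing G lam (\<Sum>i\<in>I. f i) = (\<Sum>i\<in>I. pairing G lam (f i))"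
  by (induction I rule: infinite_finite_induct) (auto simp: pairing_add)

lemma signed_vec_eq_sum:
  assumes "distinct es"
  shows "signed_vec s (set es) = (\<Sum>j<length es. axis (es ! j) (s (es ! j)))"
proof -
  have "(\<Sum>j<length es. axis (es ! j) (s (es ! j))) = (\<Sum>e\<in>set es. axis e (s e))"
    by (rule sum.reindex_bij_betw[OF bij_betw_nth[OF assms refl refl]])
  moreover have "signed_vec s (set es) = (\<Sum>e\<in>set es. axis e (s e))"
    by (simp add: vec_eq_iff axis_def)
  ultimately show ?thesis by simp
qed

lemma bij_betw_Suc_mod: "n > 0 \<Longrightarrow> bij_betw (\<lambda>j. Suc j mod n) {..<n} {..<n::nat}"
proof -
  assume n: "n > 0"
  have "inj_on (\<lambda>j. Suc j mod n) {..<n}"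
    by (auto simp: inj_on_def mod_Suc split: if_splits)
  then show ?thesis
    using n by (intro bij_betw_imageI endo_inj_surj) auto
qed

lemma sign_function_exists:
  assumes "distinct es"
  shows "\<exists>s. \<forall>j<length es. s (es ! j) = f j"
  using inv_into_f_f[OF inj_on_nth[OF assms, of "{..<length es}"]]
  by (intro exI[of _ "\<lambda>e. f (inv_into {..<length es} ((!) es) e)"]) simp

context cemetery_digraph
begin

lemma in_arcs [simp]: "e \<in> arcs G"
  by (simp add: arcs_UNIV)

lemma traverses_iff: "traverses G x e y \<longleftrightarrow> tail G e = x \<and> head G e = y"
  by (simp add: traverses_def)

lemma tail_neq_head [simp]: "tail G e \<noteq> head G e" "head G e \<noteq> tail G e"
  using no_loops[of e] by auto

lemma pairing_signed_vec: "pairing G lam (signed_vec s A) = signed_form s A lam"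
proof -
  have "(\<Sum>e\<in>UNIV. lam $ e * of_real (if e \<in> A then s e else 0)) =
      (\<Sum>e\<in>UNIV. if e \<in> A then lam $ e * of_real (s e) else 0)"
    by (intro sum.cong) auto
  then show ?thesis
    by (simp add: pairing_def signed_form_def arcs_UNIV sum.If_cases mult.commute)
qed

text \<open>Incidence without direction. Paths and cycles may run against the edges, so the
  combinatorics uses \<open>joins\<close>, and directions survive only in the signs.\<close>

definition joins :: "'v \<Rightarrow> 'e \<Rightarrow> 'v \<Rightarrow> bool" where
  "joins x e y \<longleftrightarrow> traverses G x e y \<or> traverses G y e x"

lemma joins_iff: "joins x e y \<longleftrightarrow> tail G e = x \<and> head G e = y \<or> tail G e = y \<and> head G e = x"
  by (simp add: joins_def traverses_iff)

lemma joins_commute: "joins x e y \<longleftrightarrow> joins y e x"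
  by (auto simp: joins_def)

lemma joins_in_verts: "joins x e y \<Longrightarrow> x \<in> verts G \<and> y \<in> verts G"
  unfolding joins_iff using tail_in_verts head_in_verts in_arcs by blast

lemma joins_neq: "joins x e y \<Longrightarrow> x \<noteq> y"
  by (auto simp: joins_iff)

lemma divergence_axis:
  "divergence G (axis e c) v = (if tail G e = v then c else 0) - (if head G e = v then c else 0)"
proof -
  have "(\<Sum>i\<in>{i \<in> arcs G. P i}. (axis e c :: real ^ 'e) $ i) = (if P e then c else 0)" for P
    by (simp add: axis_def arcs_UNIV sum.If_cases)
  then show ?thesis
    by (simp add: divergence_def)
qed

text \<open>An edge crossed with its sign carries one unit from \<open>x\<close> to \<open>y\<close>
  whichever way it points. This makes the divergences of paths and cycles telescope.\<close>

lemma divergence_step: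
  assumes "joins x e y"
  shows "divergence G (axis e (if traverses G x e y then 1 else - 1)) v =
    (if v = x then 1 else 0) - (if v = y then 1 else 0)"
  using assms tail_neq_head(1)[of e] by (auto simp: joins_iff divergence_axis traverses_iff)

text \<open>Each edge counts once at its origin and once, negatively, at its destination. This
  recovers the divergence at \<delta>, which \<open>unit_flows\<close> does not prescribe.\<close>

lemma sum_divergence: "(\<Sum>v\<in>verts G. divergence G z v) = 0"
proof -
  have "(\<Sum>v\<in>verts G. \<Sum>e\<in>{e \<in> arcs G. tail G e = v}. z $ e) = (\<Sum>e\<in>arcs G. z $ e)"
    by (rule sum.group) auto
  moreover have "(\<Sum>v\<in>verts G. \<Sum>e\<in>{e \<in> arcs G. head G e = v}. z $ e) = (\<Sum>e\<in>arcs G. z $ e)"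
    by (rule sum.group) auto
  ultimately show ?thesis
    by (simp add: divergence_def sum_subtractf)
qed

lemma path_seq_joins:
  "path_seq G x y xs es \<longleftrightarrow>
     x \<noteq> y \<and> length xs = Suc (length es) \<and> distinct xs \<and> hd xs = x \<and> last xs = y \<and>
     (\<forall>j<length es. joins (xs ! j) (es ! j) (xs ! Suc j))"
  by (simp add: path_seq_def joins_def)

lemma cycle_seq_joins:
  "cycle_seq G xs es \<longleftrightarrow>
     2 \<le> length es \<and> length xs = length es \<and> distinct xs \<and> distinct es \<and>
     (\<forall>j<length es. joins (xs ! j) (es ! j) (xs ! (Suc j mod length es)))"
  by (simp add: cycle_seq_def joins_def)

text \<open>An edge determines its unordered pair of end points, so a repetition at
  \<open>i \<noteq> j\<close> would force both \<open>i = Suc j\<close> and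
  \<open>Suc i = j\<close>.\<close>

lemma walk_edges_distinct:
  assumes len: "length xs = Suc (length es)" and dist: "distinct xs"
    and joins: "\<And>j. j < length es \<Longrightarrow> joins (xs ! j) (es ! j) (xs ! Suc j)"
  shows "distinct es"
proof (rule ccontr)
  assume "\<not> distinct es"
  then obtain i j where ij: "i < length es" "j < length es" "i \<noteq> j" "es ! i = es ! j"
    by (auto simp: distinct_conv_nth)
  have "xs ! i = xs ! j \<and> xs ! Suc i = xs ! Suc j \<or> xs ! i = xs ! Suc j \<and> xs ! Suc i = xs ! j"
    using joins[OF ij(1)] joins[OF ij(2)] ij(4) unfolding joins_iff by auto
  then have "i = j \<or> i = Suc j \<and> Suc i = j"
    using dist len ij by (auto simp: nth_eq_iff_index_eq)
  then show False using ij(3) by linarith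
qed

lemma divergence_path:
  assumes p: "path_seq G x y xs es"
    and s: "\<And>j. j < length es \<Longrightarrow> s (es ! j) = (if traverses G (xs ! j) (es ! j) (xs ! Suc j) then 1 else - 1)"
  shows "divergence G (signed_vec s (set es)) v = (if v = x then 1 else 0) - (if v = y then 1 else 0)"
proof -
  have len: "length xs = Suc (length es)" and j: "\<And>j. j < length es \<Longrightarrow> joins (xs ! j) (es ! j) (xs ! Suc j)"
    and dist: "distinct xs" and xy: "hd xs = x" "last xs = y"
    using p by (auto simp: path_seq_joins)
  have ne: "xs \<noteq> []" using len by auto
  have "divergence G (signed_vec s (set es)) v = (\<Sum>j<length es. divergence G (axis (es ! j) (s (es ! j))) v)"
    using walk_edges_distinct[OF len dist j] by (simp add: signed_vec_eq_sum divergence_sum)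
  also have "\<dots> = (\<Sum>j<length es. (if v = xs ! j then 1 else 0) - (if v = xs ! Suc j then 1 else 0))"
    by (intro sum.cong refl) (simp add: s j divergence_step)
  also have "\<dots> = (if v = xs ! 0 then 1 else 0) - (if v = xs ! length es then 1 else 0)"
    by (rule sum_lessThan_telescope')
  also have "\<dots> = (if v = x then 1 else 0) - (if v = y then 1 else 0)"
    using xy len ne by (simp add: hd_conv_nth last_conv_nth)
  finally show ?thesis .
qed

lemma cycle_orientation_sign:
  assumes "cycle_orientation G C s" "e \<in> C"
  shows "s e = 1 \<or> s e = - 1"
  using assms unfolding cycle_orientation_def in_set_conv_nth by (metis in_set_conv_nth)

lemma divergence_cycle:
  assumes "cycle_orientation G C s"
  shows "divergence G (signed_vec s C) v = 0"
proof -
  obtain xs es where c: "cycle_seq G xs es" "C = set es"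
    and s: "\<And>j. j < length es \<Longrightarrow>
      s (es ! j) = (if traverses G (xs ! j) (es ! j) (xs ! (Suc j mod length es)) then 1 else - 1)"
    using assms unfolding cycle_orientation_def by blast
  let ?n = "length es"
  have n: "?n > 0" "length xs = ?n" "distinct es"
    and j: "\<And>j. j < ?n \<Longrightarrow> joins (xs ! j) (es ! j) (xs ! (Suc j mod ?n))"
    using c by (auto simp: cycle_seq_joins)
  have "divergence G (signed_vec s C) v = (\<Sum>j<?n. divergence G (axis (es ! j) (s (es ! j))) v)"
    using n c by (simp add: signed_vec_eq_sum divergence_sum)
  also have "\<dots> = (\<Sum>j<?n. (if v = xs ! j then 1 else 0) - (if v = xs ! (Suc j mod ?n) then 1 else 0))"
    by (intro sum.cong refl) (simp add: s j divergence_step)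
  also have "\<dots> = (\<Sum>j<?n. if v = xs ! j then 1 else 0) - (\<Sum>j<?n. if v = xs ! (Suc j mod ?n) then 1 else 0)"
    by (simp add: sum_subtractf)
  also have "(\<Sum>j<?n. if v = xs ! (Suc j mod ?n) then 1 else 0) = (\<Sum>j<?n. if v = xs ! j then 1 else (0::real))"
    by (rule sum.reindex_bij_betw[OF bij_betw_Suc_mod[OF n(1)]])
  finally show ?thesis by simp
qed

section \<open>Cycles in the support of a flow\<close>

lemma finite_walk_lengths:
  "length xs = Suc (length es) \<Longrightarrow> distinct xs \<Longrightarrow> set xs \<subseteq> verts G \<Longrightarrow> length es < card (verts G)"
  using card_mono[OF finite_verts, of "set xs"] by (simp add: distinct_card)

text \<open>A longest path in \<open>S\<close> cannot be prolonged, so its last vertex closes a cycle.\<close>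

lemma cycle_exists:
  assumes "S \<noteq> {}"
    and deg: "\<And>e x y. e \<in> S \<Longrightarrow> joins x e y \<Longrightarrow> \<exists>e'\<in>S. e' \<noteq> e \<and> (\<exists>w. joins y e' w)"
  shows "\<exists>C. simple_cycle G C \<and> C \<subseteq> S"
proof -
  define W where "W xs es \<longleftrightarrow> es \<noteq> [] \<and> set es \<subseteq> S \<and> length xs = Suc (length es) \<and> distinct xs \<and>
    (\<forall>j<length es. joins (xs ! j) (es ! j) (xs ! Suc j))" for xs es
  have Wv: "set xs \<subseteq> verts G" if "W xs es" for xs es
  proof
    fix v assume "v \<in> set xs"
    then obtain j where j: "j < length xs" "v = xs ! j" by (auto simp: in_set_conv_nth)
    show "v \<in> verts G"
    proof (cases "j < length es")
      case True
      then show ?thesis using that j joins_in_verts unfolding W_def by blast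
    next
      case False
      then have "j = Suc (length es - 1)" "length es - 1 < length es"
        using that j by (auto simp: W_def)
      then show ?thesis using that j joins_in_verts unfolding W_def by blast
    qed
  qed
  obtain e where e: "e \<in> S" using assms(1) by blast
  have W0: "W [tail G e, head G e] [e]"
    using e by (simp add: W_def joins_iff)
  have "\<exists>p. (case p of (xs, es) \<Rightarrow> W xs es) \<and> (\<forall>q. (case q of (xs, es) \<Rightarrow> W xs es) \<longrightarrow> length (snd q) \<le> length (snd p))"
    by (rule ex_has_greatest_nat[where k = "([tail G e, head G e], [e])" and b = "card (verts G)"])
      (use W0 Wv in \<open>auto simp: W_def intro: less_imp_le finite_walk_lengths\<close>)
  then obtain xs es where W: "W xs es" and max: "\<And>xs' es'. W xs' es' \<Longrightarrow> length es' \<le> length es"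
    by fastforce
  let ?n = "length es"
  have n: "?n > 0" "length xs = Suc ?n" "distinct xs" "set es \<subseteq> S"
    and j: "\<And>j. j < ?n \<Longrightarrow> joins (xs ! j) (es ! j) (xs ! Suc j)"
    using W by (auto simp: W_def)
  have des: "distinct es" using walk_edges_distinct[OF n(2,3) j] .
  have lj: "joins (xs ! (?n - 1)) (es ! (?n - 1)) (xs ! ?n)" using j[of "?n - 1"] n by simp
  moreover have "es ! (?n - 1) \<in> S" using n nth_mem[of "?n - 1" es] by auto
  ultimately obtain e' w where e': "e' \<in> S" "e' \<noteq> es ! (?n - 1)" "joins (xs ! ?n) e' w"
    using deg by blast
  have "w \<in> set xs"
  proof (rule ccontr)
    assume "w \<notin> set xs"
    then have "W (xs @ [w]) (es @ [e'])"
      using n e' j by (auto simp: W_def nth_append less_Suc_eq)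
    from max[OF this] show False by simp
  qed
  then obtain i where i: "i < length xs" "w = xs ! i" by (auto simp: in_set_conv_nth)
  have in': "i < ?n" using i n joins_neq[OF e'(3)] by (cases "i = ?n") auto
  \<comment> \<open>Among the edges of the path only the last one touches its last vertex. Newness
    matters when \<open>w\<close> is the last vertex but one: the cycle then consists of two
    antiparallel edges.\<close>
  have e'_new: "e' \<notin> set es"
  proof
    assume "e' \<in> set es"
    then obtain k where k: "k < ?n" "e' = es ! k" by (auto simp: in_set_conv_nth)
    have "xs ! ?n = xs ! k \<or> xs ! ?n = xs ! Suc k"
      using j[OF k(1)] e'(3) k(2) by (auto simp: joins_iff)
    then have "?n = k \<or> ?n = Suc k" using n k by (auto simp: nth_eq_iff_index_eq)
    then show False using k e'(2) by auto
  qed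
  have "cycle_seq G (drop i xs) (drop i es @ [e'])"
    unfolding cycle_seq_joins
  proof (intro conjI allI impI)
    show "2 \<le> length (drop i es @ [e'])" using in' by simp
    show "length (drop i xs) = length (drop i es @ [e'])" using in' n by simp
    show "distinct (drop i xs)" "distinct (drop i es @ [e'])"
      using n des e'_new by (auto dest: in_set_dropD)
    fix k assume k: "k < length (drop i es @ [e'])"
    show "joins (drop i xs ! k) ((drop i es @ [e']) ! k) (drop i xs ! (Suc k mod length (drop i es @ [e'])))"
    proof (cases "k = ?n - i")
      case True
      then show ?thesis using e' i in' n by (simp add: nth_append)
    next
      case False
      then show ?thesis using j[of "i + k"] k in' n by (simp add: nth_append)
    qed
  qed
  then have "simple_cycle G (set (drop i es @ [e']))" unfolding simple_cycle_def by blast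
  moreover have "set (drop i es @ [e']) \<subseteq> S" using n e' by (auto dest: in_set_dropD)
  ultimately show ?thesis by blast
qed

text \<open>The support of a nonzero flow without divergence has no leaf, since at a leaf the
  divergence is plus or minus the value of the only edge there. Hence it contains a cycle. At
  \<delta> the divergence vanishes because all divergences sum to 0.\<close>

lemma acyclic_flow_zero:
  assumes acyclic: "\<And>C. simple_cycle G C \<Longrightarrow> \<not> C \<subseteq> T"
    and supp: "\<And>e. e \<notin> T \<Longrightarrow> z $ e = 0"
    and div: "\<And>v. v \<in> verts G - {\<delta>} \<Longrightarrow> divergence G z v = 0"
  shows "z = 0"
proof (rule ccontr)
  assume nz: "z \<noteq> 0"
  define S where "S = {e. z $ e \<noteq> 0}"
  have "(\<Sum>v\<in>verts G. divergence G z v) = divergence G z \<delta> + (\<Sum>v\<in>verts G - {\<delta>}. divergence G z v)"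
    by (rule sum.remove[OF finite_verts cemetery_in_verts])
  also have "(\<Sum>v\<in>verts G - {\<delta>}. divergence G z v) = 0"
    by (rule sum.neutral) (use div in blast)
  finally have "divergence G z \<delta> = 0"
    using sum_divergence[of z] by linarith
  then have div: "divergence G z v = 0" if "v \<in> verts G" for v
    using div that by blast
  have deg: "\<exists>e'\<in>S. e' \<noteq> e \<and> (\<exists>w. joins y e' w)" if e: "e \<in> S" and xy: "joins x e y" for e x y
  proof (rule ccontr)
    assume "\<not> ?thesis"
    then have *: "z $ e' = 0" if "e' \<noteq> e" "tail G e' = y \<or> head G e' = y" for e'
      using that by (auto simp: S_def joins_iff)
    have "(\<Sum>e'\<in>{e' \<in> arcs G. tail G e' = y}. z $ e') = (\<Sum>e'\<in>{e' \<in> arcs G. tail G e' = y}. if e' = e then z $ e else 0)"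
      by (intro sum.cong) (use * in auto)
    moreover have "(\<Sum>e'\<in>{e' \<in> arcs G. head G e' = y}. z $ e') = (\<Sum>e'\<in>{e' \<in> arcs G. head G e' = y}. if e' = e then z $ e else 0)"
      by (intro sum.cong) (use * in auto)
    ultimately have "divergence G z y = (if tail G e = y then z $ e else 0) - (if head G e = y then z $ e else 0)"
      by (simp add: divergence_def)
    then show False
      using div[of y] joins_in_verts[OF xy] xy e tail_neq_head(1)[of e] by (auto simp: joins_iff S_def split: if_splits)
  qed
  have "S \<noteq> {}" using nz by (auto simp: S_def vec_eq_iff)
  then have "\<exists>C. simple_cycle G C \<and> C \<subseteq> S"
    by (rule cycle_exists) (rule deg)
  then obtain C where "simple_cycle G C" "C \<subseteq> S" by blast
  then show False using acyclic[of C] supp by (auto simp: S_def)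
qed

section \<open>Connectivity through edges in either direction\<close>

lemma path_seq_extend:
  assumes p: "path_seq G x y xs es" and j: "joins y e z" and "z \<noteq> x"
  shows "\<exists>xs' es'. path_seq G x z xs' es' \<and> set es' \<subseteq> insert e (set es)"
proof (cases "z \<in> set xs")
  case False
  have "path_seq G x z (xs @ [z]) (es @ [e])"
    using p j False \<open>z \<noteq> x\<close>
    by (auto simp: path_seq_joins nth_append less_Suc_eq last_conv_nth hd_append)
  then show ?thesis by fastforce
next
  case True
  \<comment> \<open>A vertex already visited cuts the path back to that visit, which keeps the
    vertices distinct.\<close>
  then obtain i where i: "i < length xs" "z = xs ! i" by (auto simp: in_set_conv_nth)
  have i0: "i > 0" using i p \<open>z \<noteq> x\<close> by (cases i) (auto simp: path_seq_joins hd_conv_nth)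
  have "path_seq G x z (take (Suc i) xs) (take i es)"
    unfolding path_seq_joins
  proof (intro conjI allI impI)
    show "hd (take (Suc i) xs) = x" using p by (simp add: path_seq_joins)
    show "last (take (Suc i) xs) = z" using i by (simp add: take_Suc_conv_app_nth)
    fix j assume j: "j < length (take i es)"
    then show "joins (take (Suc i) xs ! j) (take i es ! j) (take (Suc i) xs ! Suc j)"
      using p by (simp add: path_seq_joins)
  qed (use p i i0 \<open>z \<noteq> x\<close> in \<open>auto simp: path_seq_joins\<close>)
  then show ?thesis by (fastforce dest: in_set_takeD)
qed

text \<open>Through the closure of this relation connections can be composed and rerouted without
  keeping vertices distinct; \<open>simple_path_of_rtrancl\<close> extracts a simple path at the
  end.\<close>

definition adj :: "'e set \<Rightarrow> ('v \<times> 'v) set" where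
  "adj S = {(x, y). \<exists>e\<in>S. joins x e y}"

lemma adj_mono: "S \<subseteq> S' \<Longrightarrow> adj S \<subseteq> adj S'"
  by (auto simp: adj_def)

lemma sym_adj: "sym (adj S)"
  by (auto simp: adj_def sym_def joins_commute)

lemma simple_path_of_rtrancl:
  assumes "(x, y) \<in> (adj S)\<^sup>*" "x \<noteq> y"
  shows "\<exists>xs es. path_seq G x y xs es \<and> set es \<subseteq> S"
  using assms
proof (induction rule: rtrancl_induct)
  case base
  then show ?case by simp
next
  case (step y z)
  obtain e where e: "e \<in> S" "joins y e z" using step(2) by (auto simp: adj_def)
  show ?case
  proof (cases "x = y")
    case True
    then have "path_seq G x z [x, z] [e]"
      using e joins_neq[OF e(2)] by (simp add: path_seq_joins)
    then show ?thesis using e by fastforce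
  next
    case False
    then obtain xs es where "path_seq G x y xs es" "set es \<subseteq> S" using step.IH by blast
    then show ?thesis using path_seq_extend[of x y xs es e z] e step.prems by blast
  qed
qed

lemma rtrancl_of_path_seq:
  assumes "path_seq G x y xs es" "set es \<subseteq> S"
  shows "(x, y) \<in> (adj S)\<^sup>*"
proof -
  have len: "length xs = Suc (length es)" and j: "\<And>j. j < length es \<Longrightarrow> joins (xs ! j) (es ! j) (xs ! Suc j)"
    and xy: "hd xs = x" "last xs = y"
    using assms by (auto simp: path_seq_joins)
  have "(xs ! 0, xs ! k) \<in> (adj S)\<^sup>*" if "k \<le> length es" for k
    using that
  proof (induction k)
    case (Suc k)
    then have "(xs ! k, xs ! Suc k) \<in> adj S"
      using j[of k] assms(2) nth_mem[of k es] Suc_le_lessD unfolding adj_def by blast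
    then show ?case using Suc by (auto intro: rtrancl_into_rtrancl)
  qed simp
  from this[of "length es"] show ?thesis
    using xy len hd_conv_nth[of xs] last_conv_nth[of xs] by force
qed

text \<open>Starting at the far end of \<open>e\<close> and going round the cycle, one reaches its
  near end through the other edges.\<close>

lemma cycle_remove_edge_connected:
  assumes "cycle_seq G xs es" "e \<in> set es" "joins x e y"
  shows "(x, y) \<in> (adj (set es - {e}))\<^sup>*"
proof -
  let ?n = "length es" and ?R = "(adj (set es - {e}))\<^sup>*"
  have n: "?n \<ge> 2" "length xs = ?n" "distinct es"
    and j: "\<And>j. j < ?n \<Longrightarrow> joins (xs ! j) (es ! j) (xs ! (Suc j mod ?n))"
    using assms by (auto simp: cycle_seq_joins)
  obtain k where k: "k < ?n" "e = es ! k" using assms(2) by (auto simp: in_set_conv_nth)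
  have "(xs ! (Suc k mod ?n), xs ! (Suc (k + m) mod ?n)) \<in> ?R" if "m < ?n" for m
    using that
  proof (induction m)
    case (Suc m)
    let ?i = "Suc (k + m) mod ?n"
    have i: "?i < ?n" using n by (intro mod_less_divisor) auto
    \<comment> \<open>The index \<open>k\<close> of \<open>e\<close> comes back only after a full
      turn of \<open>?n\<close> steps, and fewer have been made.\<close>
    have "?i \<noteq> k"
    proof
      assume "?i = k"
      then have "[k + Suc m = k + 0] (mod ?n)" using k by (simp add: cong_def)
      then have "[Suc m = 0] (mod ?n)" unfolding cong_add_lcancel_nat .
      then show False using Suc.prems by (simp add: cong_def)
    qed
    then have "es ! ?i \<noteq> e" using n k i by (simp add: nth_eq_iff_index_eq)
    moreover have "joins (xs ! ?i) (es ! ?i) (xs ! (Suc (k + Suc m) mod ?n))"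
      using j[OF i] by (simp add: mod_Suc_eq)
    ultimately have "(xs ! ?i, xs ! (Suc (k + Suc m) mod ?n)) \<in> adj (set es - {e})"
      using i by (auto simp: adj_def)
    then show ?case using Suc by (auto intro: rtrancl_into_rtrancl)
  qed simp
  moreover have "Suc (k + (?n - 1)) = k + ?n" using n by simp
  then have "Suc (k + (?n - 1)) mod ?n = k" using k by simp
  moreover have "?n - 1 < ?n" using n by simp
  ultimately have *: "(xs ! (Suc k mod ?n), xs ! k) \<in> ?R"
    by metis
  then have "(xs ! k, xs ! (Suc k mod ?n)) \<in> ?R"
    using sym_rtrancl[OF sym_adj] by (meson symD)
  with * show ?thesis
    using j[OF k(1)] assms(3) k(2) by (auto simp: joins_iff)
qed

lemma tree_connected:
  assumes "T \<in> spanning_trees G" "x \<in> verts G" "y \<in> verts G"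
  shows "(x, y) \<in> (adj T)\<^sup>*"
proof (cases "x = y")
  case False
  then obtain xs es where "path_seq G x y xs es" "set es \<subseteq> T"
    using assms unfolding spanning_trees_def simple_path_def by blast
  then show ?thesis by (rule rtrancl_of_path_seq)
qed simp

section \<open>Fundamental cycles, exchanges and paths of spanning trees\<close>

lemma tree_acyclic: "T \<in> spanning_trees G \<Longrightarrow> simple_cycle G C \<Longrightarrow> \<not> C \<subseteq> T"
  by (auto simp: spanning_trees_def)

lemma tree_flow_zero:
  assumes "T \<in> spanning_trees G" "\<And>e. e \<notin> T \<Longrightarrow> z $ e = 0"
    and "\<And>v. v \<in> verts G - {\<delta>} \<Longrightarrow> divergence G z v = 0"
  shows "z = 0"
  using acyclic_flow_zero[of T z] assms tree_acyclic by blast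

lemma spanning_treeI:
  assumes "\<And>C. simple_cycle G C \<Longrightarrow> \<not> C \<subseteq> T"
    and "\<And>x y. x \<in> verts G \<Longrightarrow> y \<in> verts G \<Longrightarrow> (x, y) \<in> (adj T)\<^sup>*"
  shows "T \<in> spanning_trees G"
  unfolding spanning_trees_def simple_path_def
  using assms simple_path_of_rtrancl by (fastforce simp: arcs_UNIV)

lemma fundamental_cycle_exists:
  assumes T: "T \<in> spanning_trees G" and e: "e \<notin> T"
  shows "\<exists>C. simple_cycle G C \<and> e \<in> C \<and> C \<subseteq> insert e T"
proof -
  have "(head G e, tail G e) \<in> (adj T)\<^sup>*"
    using tree_connected[OF T] tail_in_verts head_in_verts by simp
  then obtain xs es where p: "path_seq G (head G e) (tail G e) xs es" "set es \<subseteq> T"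
    using simple_path_of_rtrancl tail_neq_head by blast
  let ?n = "length es"
  have len: "length xs = Suc ?n" and dist: "distinct xs"
    and j: "\<And>j. j < ?n \<Longrightarrow> joins (xs ! j) (es ! j) (xs ! Suc j)"
    and xy: "xs ! 0 = head G e" "xs ! ?n = tail G e"
    using p(1) by (auto simp: path_seq_joins hd_conv_nth last_conv_nth simp del: length_greater_0_conv)
      (metis Zero_not_Suc diff_Suc_1 hd_conv_nth last_conv_nth list.size(3))+
  \<comment> \<open>Without loops the tree path is nonempty, so closing it by \<open>e\<close> gives
    at least two edges.\<close>
  have "?n \<noteq> 0" using xy tail_neq_head[of e] by (cases es) auto
  have "joins (xs ! j) ((es @ [e]) ! j) (xs ! (Suc j mod Suc ?n))" if "j < Suc ?n" for j
  proof (cases "j = ?n")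
    case True
    then show ?thesis using xy by (simp add: joins_iff)
  next
    case False
    then show ?thesis using j[of j] that by (simp add: nth_append)
  qed
  then have "cycle_seq G xs (es @ [e])"
    using walk_edges_distinct[OF len dist j] len dist p(2) e \<open>?n \<noteq> 0\<close>
    by (auto simp: cycle_seq_joins Suc_le_eq)
  then have "simple_cycle G (set (es @ [e]))" unfolding simple_cycle_def by blast
  then show ?thesis using p(2) by (intro exI[of _ "set (es @ [e])"]) auto
qed

lemma orientation_exists: "simple_cycle G C \<Longrightarrow> \<exists>s. cycle_orientation G C s"
proof -
  assume "simple_cycle G C"
  then obtain xs es where c: "cycle_seq G xs es" "C = set es" by (auto simp: simple_cycle_def)
  then have "distinct es" by (simp add: cycle_seq_def)
  from sign_function_exists[OF this] obtain s :: "'e \<Rightarrow> real" where "\<forall>j<length es. s (es ! j) =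
      (if traverses G (xs ! j) (es ! j) (xs ! (Suc j mod length es)) then 1 else - 1)" ..
  with c show ?thesis unfolding cycle_orientation_def by blast
qed

text \<open>Both cycles carry circulations, which can be scaled to agree at \<open>e\<close>.\<close>

lemma fundamental_cycle_unique:
  assumes T: "T \<in> spanning_trees G"
    and C: "simple_cycle G C" "C \<subseteq> insert e T" and C': "simple_cycle G C'" "C' \<subseteq> insert e T"
  shows "C = C'"
proof -
  obtain s s' where s: "cycle_orientation G C s" and s': "cycle_orientation G C' s'"
    using orientation_exists C C' by metis
  have e: "e \<in> C" "e \<in> C'" "e \<notin> T"
    using tree_acyclic[OF T C(1)] tree_acyclic[OF T C'(1)] C(2) C'(2) by auto
  let ?z = "s e *\<^sub>R signed_vec s C - s' e *\<^sub>R signed_vec s' C'"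
  have "?z = 0"
  proof (rule tree_flow_zero[OF T])
    show "?z $ e' = 0" if "e' \<notin> T" for e'
      using that e C C' cycle_orientation_sign[OF s e(1)] cycle_orientation_sign[OF s' e(2)] by auto
    show "divergence G ?z v = 0" for v
      by (simp add: divergence_diff divergence_scaleR divergence_cycle[OF s] divergence_cycle[OF s'])
  qed
  then have "s e * (if i \<in> C then s i else 0) = s' e * (if i \<in> C' then s' i else 0)" for i
    by (simp add: vec_eq_iff)
  moreover have "s i \<noteq> 0" if "i \<in> C" for i
    using cycle_orientation_sign[OF s that] by auto
  moreover have "s' i \<noteq> 0" if "i \<in> C'" for i
    using cycle_orientation_sign[OF s' that] by auto
  ultimately have "i \<in> C \<longleftrightarrow> i \<in> C'" for i
    using e by (cases "i \<in> C"; cases "i \<in> C'") (metis mult_eq_0_iff)+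
  then show ?thesis by blast
qed

text \<open>The only cycle inside \<open>insert e\<^sub>0 T\<close> loses an edge, and connections
  through \<open>e\<close> are rerouted along the rest of \<open>C\<close>. The case
  \<open>e = e\<^sub>0\<close> is included and returns \<open>T\<close>, as in the diagonal term of
  the cycle endomorphism.\<close>

lemma exchange_spanning_tree:
  assumes T: "T \<in> spanning_trees G" and C: "simple_cycle G C" "C \<subseteq> insert e\<^sub>0 T" and e: "e \<in> C"
  shows "insert e\<^sub>0 T - {e} \<in> spanning_trees G"
proof (rule spanning_treeI)
  show "\<not> C' \<subseteq> insert e\<^sub>0 T - {e}" if "simple_cycle G C'" for C'
    using fundamental_cycle_unique[OF T C that] e by blast
  obtain xs es where c: "cycle_seq G xs es" "C = set es" using C by (auto simp: simple_cycle_def)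
  have "adj T \<subseteq> (adj (insert e\<^sub>0 T - {e}))\<^sup>*"
  proof
    fix p assume "p \<in> adj T"
    then obtain x y f where f: "p = (x, y)" "f \<in> T" "joins x f y" by (auto simp: adj_def)
    show "p \<in> (adj (insert e\<^sub>0 T - {e}))\<^sup>*"
    proof (cases "f = e")
      case True
      then have "p \<in> (adj (C - {e}))\<^sup>*"
        using cycle_remove_edge_connected[OF c(1), of e x y] c e f by simp
      then show ?thesis using rtrancl_mono[OF adj_mono, of "C - {e}"] C(2) by blast
    next
      case False
      then show ?thesis using f by (auto simp: adj_def)
    qed
  qed
  then have "(adj T)\<^sup>* \<subseteq> (adj (insert e\<^sub>0 T - {e}))\<^sup>*" by (rule rtrancl_subset_rtrancl)
  then show "(x, y) \<in> (adj (insert e\<^sub>0 T - {e}))\<^sup>*" if "x \<in> verts G" "y \<in> verts G" for x y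
    using tree_connected[OF T that] by blast
qed

text \<open>Both paths carry flows of equal divergence. Comparing signed vectors instead of edge
  sets also fixes the directions.\<close>

lemma tree_path_unique:
  assumes T: "T \<in> spanning_trees G"
    and p: "path_seq G x y xs es" "set es \<subseteq> T" and p': "path_seq G x y xs' es'" "set es' \<subseteq> T"
    and s: "\<And>j. j < length es \<Longrightarrow> s (es ! j) = (if traverses G (xs ! j) (es ! j) (xs ! Suc j) then 1 else - 1)"
    and s': "\<And>j. j < length es' \<Longrightarrow> s' (es' ! j) = (if traverses G (xs' ! j) (es' ! j) (xs' ! Suc j) then 1 else - 1)"
  shows "signed_vec s (set es) = signed_vec s' (set es')"
proof -
  have "signed_vec s (set es) - signed_vec s' (set es') = 0"
    by (rule tree_flow_zero[OF T])
      (use p p' in \<open>auto simp: divergence_diff divergence_path[OF p(1) s] divergence_path[OF p'(1) s']\<close>)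
  then show ?thesis by simp
qed

text \<open>\<open>path_sign\<close> asks for some presentation of the path that runs along the
  edge. In a tree, a second presentation with the opposite direction would carry a different signed
  vector.\<close>

lemma path_sign_in_tree:
  assumes T: "T \<in> spanning_trees G" and p: "path_seq G x y xs es" "set es \<subseteq> T" and j: "j < length es"
  shows "path_sign G x y (set es) (es ! j) = (if traverses G (xs ! j) (es ! j) (xs ! Suc j) then 1 else - 1)"
proof (cases "traverses G (xs ! j) (es ! j) (xs ! Suc j)")
  case True
  then show ?thesis using p j unfolding path_sign_def by auto
next
  case False
  have dist: "distinct es'" if "path_seq G x y xs' es'" for xs' es'
    using that walk_edges_distinct[of xs' es'] by (auto simp: path_seq_joins)
  have "\<not> traverses G (xs' ! k) (es' ! k) (xs' ! Suc k)"
    if p': "path_seq G x y xs' es'" "set es = set es'" and k: "k < length es'" "es' ! k = es ! j" for xs' es' k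
  proof
    assume t: "traverses G (xs' ! k) (es' ! k) (xs' ! Suc k)"
    obtain s where s: "\<forall>j<length es. s (es ! j) = (if traverses G (xs ! j) (es ! j) (xs ! Suc j) then 1 else - 1 :: real)"
      using sign_function_exists[OF dist[OF p(1)]] ..
    obtain s' where s': "\<forall>j<length es'. s' (es' ! j) = (if traverses G (xs' ! j) (es' ! j) (xs' ! Suc j) then 1 else - 1 :: real)"
      using sign_function_exists[OF dist[OF p'(1)]] ..
    have "signed_vec s (set es) = signed_vec s' (set es')"
      by (rule tree_path_unique[OF T p p'(1)]) (use p p' s s' in auto)
    then have "signed_vec s (set es) $ (es ! j) = signed_vec s' (set es') $ (es ! j)" by simp
    then have "s (es ! j) = s' (es' ! k)"
      using j k p'(2) nth_mem[of j es] by simp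
    moreover have "s (es ! j) = - 1" using s j False by simp
    moreover have "s' (es' ! k) = 1" using s' k(1) t by simp
    ultimately show False by simp
  qed
  then show ?thesis using False unfolding path_sign_def by auto
qed

section \<open>The flows of a spanning tree and the inverse of its chart\<close>

definition fundamental_flow :: "'e set \<Rightarrow> 'e \<Rightarrow> real ^ 'e" where
  "fundamental_flow T e\<^sub>0 = (SOME z. (\<forall>v. divergence G z v = 0) \<and> z $ e\<^sub>0 = 1 \<and> (\<forall>e. e \<notin> insert e\<^sub>0 T \<longrightarrow> z $ e = 0))"

text \<open>The properties that define \<open>fundamental_flow\<close> involve no orientation.
  Multiplication by \<open>s e\<^sub>0\<close>, which is \<plusminus>1, normalizes the cycle flow to
  1 at \<open>e\<^sub>0\<close>, and two candidates differ by a flow supported on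
  \<open>T\<close>.\<close>

lemma fundamental_flow_eq:
  assumes T: "T \<in> spanning_trees G" and e\<^sub>0: "e\<^sub>0 \<notin> T"
    and C: "simple_cycle G C" "C \<subseteq> insert e\<^sub>0 T" and s: "cycle_orientation G C s"
  shows "fundamental_flow T e\<^sub>0 = s e\<^sub>0 *\<^sub>R signed_vec s C"
proof -
  let ?P = "\<lambda>z. (\<forall>v. divergence G z v = 0) \<and> z $ e\<^sub>0 = 1 \<and> (\<forall>e. e \<notin> insert e\<^sub>0 T \<longrightarrow> z $ e = 0)"
  have e: "e\<^sub>0 \<in> C" using tree_acyclic[OF T C(1)] C(2) by auto
  have P: "?P (s e\<^sub>0 *\<^sub>R signed_vec s C)"
    using e cycle_orientation_sign[OF s e] C(2) by (auto simp: divergence_scaleR divergence_cycle[OF s])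
  then have "?P (fundamental_flow T e\<^sub>0)"
    unfolding fundamental_flow_def by (rule someI)
  have "z - w = 0" if "?P z" "?P w" for z w
  proof (rule tree_flow_zero[OF T])
    show "(z - w) $ e = 0" if "e \<notin> T" for e
      using that \<open>?P z\<close> \<open>?P w\<close> by (cases "e = e\<^sub>0") simp_all
    show "divergence G (z - w) v = 0" for v
      using \<open>?P z\<close> \<open>?P w\<close> by (simp add: divergence_diff)
  qed
  from this[OF \<open>?P (fundamental_flow T e\<^sub>0)\<close> P] show ?thesis by simp
qed

lemma fundamental_flow:
  assumes T: "T \<in> spanning_trees G" and e\<^sub>0: "e\<^sub>0 \<notin> T"
  shows divergence_fundamental_flow: "divergence G (fundamental_flow T e\<^sub>0) v = 0"
    and fundamental_flow_base: "fundamental_flow T e\<^sub>0 $ e\<^sub>0 = 1"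
    and fundamental_flow_nth: "e \<notin> T \<Longrightarrow> e \<noteq> e\<^sub>0 \<Longrightarrow> fundamental_flow T e\<^sub>0 $ e = 0"
proof -
  obtain C s where C: "simple_cycle G C" "e\<^sub>0 \<in> C" "C \<subseteq> insert e\<^sub>0 T" and s: "cycle_orientation G C s"
    using fundamental_cycle_exists[OF T e\<^sub>0] orientation_exists by blast
  note * = fundamental_flow_eq[OF T e\<^sub>0 C(1,3) s]
  show "divergence G (fundamental_flow T e\<^sub>0) v = 0" 
    by (simp add: * divergence_scaleR divergence_cycle[OF s])
  show "fundamental_flow T e\<^sub>0 $ e\<^sub>0 = 1"
    using cycle_orientation_sign[OF s C(2)] C(2) by (auto simp: *)
  show "e \<notin> T \<Longrightarrow> e \<noteq> e\<^sub>0 \<Longrightarrow> fundamental_flow T e\<^sub>0 $ e = 0"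
    using C by (auto simp: *)
qed

text \<open>The origin of the chart: the unit flow whose coordinates off \<open>T\<close> vanish.
  Its entries may be negative.\<close>

definition tree_flow :: "'e set \<Rightarrow> real ^ 'e" where
  "tree_flow T = (SOME z. (\<forall>v\<in>verts G - {\<delta>}. divergence G z v = (if v = x\<^sub>0 then 1 else 0)) \<and>
     (\<forall>e. e \<notin> T \<longrightarrow> z $ e = 0))"

lemma tree_flow_eq:
  assumes T: "T \<in> spanning_trees G" and \<sigma>: "simple_path G x\<^sub>0 \<delta> \<sigma>" "\<sigma> \<subseteq> T"
  shows "tree_flow T = signed_vec (path_sign G x\<^sub>0 \<delta> \<sigma>) \<sigma>"
proof -
  let ?P = "\<lambda>z. (\<forall>v\<in>verts G - {\<delta>}. divergence G z v = (if v = x\<^sub>0 then 1 else 0)) \<and>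
     (\<forall>e. e \<notin> T \<longrightarrow> z $ e = 0)"
  obtain xs es where p: "path_seq G x\<^sub>0 \<delta> xs es" "\<sigma> = set es" using \<sigma> by (auto simp: simple_path_def)
  let ?z = "signed_vec (path_sign G x\<^sub>0 \<delta> \<sigma>) \<sigma>"
  have "divergence G ?z v = (if v = x\<^sub>0 then 1 else 0) - (if v = \<delta> then 1 else 0)" for v
    unfolding p(2) by (rule divergence_path[OF p(1)]) (use path_sign_in_tree[OF T p(1)] p(2) \<sigma> in auto)
  then have P: "?P ?z" using \<sigma> by auto
  then have "?P (tree_flow T)"
    unfolding tree_flow_def by (rule someI)
  with P have "tree_flow T - ?z = 0"
    by (intro tree_flow_zero[OF T]) (auto simp: divergence_diff)
  then show ?thesis by simp
qed

lemma tree_path_exists: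
  "T \<in> spanning_trees G \<Longrightarrow> \<exists>\<sigma>. simple_path G x\<^sub>0 \<delta> \<sigma> \<and> \<sigma> \<subseteq> T"
  using base_in_verts cemetery_in_verts by (auto simp: spanning_trees_def)

lemma tree_flow:
  assumes T: "T \<in> spanning_trees G"
  shows tree_flow_nth: "e \<notin> T \<Longrightarrow> tree_flow T $ e = 0"
    and tree_flow_unit: "tree_flow T \<in> unit_flows G \<delta> x\<^sub>0"
proof -
  obtain \<sigma> where \<sigma>: "simple_path G x\<^sub>0 \<delta> \<sigma>" "\<sigma> \<subseteq> T" using tree_path_exists[OF T] by blast
  obtain xs es where p: "path_seq G x\<^sub>0 \<delta> xs es" "\<sigma> = set es" using \<sigma> by (auto simp: simple_path_def)
  have "divergence G (signed_vec (path_sign G x\<^sub>0 \<delta> \<sigma>) \<sigma>) v = (if v = x\<^sub>0 then 1 else 0) - (if v = \<delta> then 1 else 0)" for v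
    unfolding p(2) by (rule divergence_path[OF p(1)]) (use path_sign_in_tree[OF T p(1)] p(2) \<sigma> in auto)
  then show "tree_flow T \<in> unit_flows G \<delta> x\<^sub>0"
    by (simp add: unit_flows_def tree_flow_eq[OF T \<sigma>])
  show "e \<notin> T \<Longrightarrow> tree_flow T $ e = 0"
    using \<sigma> by (auto simp: tree_flow_eq[OF T \<sigma>])
qed

text \<open>Inverse of \<open>tree_chart\<close>, defined for all real coordinates. Positivity is
  left to the integrand, so that integrals run over a full product space.\<close>

definition flow_section :: "'e set \<Rightarrow> ('e \<Rightarrow> real) \<Rightarrow> real ^ 'e" where
  "flow_section T y = tree_flow T + (\<Sum>e\<in>- T. y e *\<^sub>R fundamental_flow T e)"

lemma flow_section_nth:
  assumes T: "T \<in> spanning_trees G" and e: "e \<notin> T"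
  shows "flow_section T y $ e = y e"
proof -
  have "(\<Sum>i\<in>- T. y i * fundamental_flow T i $ e) = (\<Sum>i\<in>- T. if i = e then y e else 0)"
    using e by (intro sum.cong) (auto simp: fundamental_flow_base[OF T] fundamental_flow_nth[OF T])
  then show ?thesis
    using e by (simp add: flow_section_def tree_flow_nth[OF T])
qed

lemma flow_section_unit:
  assumes T: "T \<in> spanning_trees G"
  shows "flow_section T y \<in> unit_flows G \<delta> x\<^sub>0"
proof -
  have "divergence G (flow_section T y) v = divergence G (tree_flow T) v" for v
    by (simp add: flow_section_def divergence_add divergence_sum divergence_scaleR divergence_fundamental_flow[OF T])
  then show ?thesis using tree_flow_unit[OF T] by (simp add: unit_flows_def)
qed

lemma flow_section_unique:
  assumes T: "T \<in> spanning_trees G" and z: "z \<in> unit_flows G \<delta> x\<^sub>0" "\<And>e. e \<notin> T \<Longrightarrow> z $ e = y e"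
  shows "flow_section T y = z"
proof -
  have "flow_section T y - z = 0"
    using z flow_section_unit[OF T, of y]
    by (intro tree_flow_zero[OF T]) (auto simp: flow_section_nth[OF T] divergence_diff unit_flows_def)
  then show ?thesis by simp
qed

text \<open>The flow with coordinate \<open>e\<^sub>0\<close> set to 0, a function of the other
  coordinates alone. It is the origin of a line in the direction of the fundamental cycle.\<close>

definition flow_base :: "'e set \<Rightarrow> 'e \<Rightarrow> ('e \<Rightarrow> real) \<Rightarrow> real ^ 'e" where
  "flow_base T e\<^sub>0 y = tree_flow T + (\<Sum>e\<in>- insert e\<^sub>0 T. y e *\<^sub>R fundamental_flow T e)"

lemma flow_section_upd:
  assumes "e\<^sub>0 \<notin> T"
  shows "flow_section T (y(e\<^sub>0 := t)) = flow_base T e\<^sub>0 y + t *\<^sub>R fundamental_flow T e\<^sub>0"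
proof -
  have "- T = insert e\<^sub>0 (- insert e\<^sub>0 T)" using assms by auto
  then have "(\<Sum>e\<in>- T. (y(e\<^sub>0 := t)) e *\<^sub>R fundamental_flow T e) =
      t *\<^sub>R fundamental_flow T e\<^sub>0 + (\<Sum>e\<in>- insert e\<^sub>0 T. (y(e\<^sub>0 := t)) e *\<^sub>R fundamental_flow T e)"
    by simp
  also have "(\<Sum>e\<in>- insert e\<^sub>0 T. (y(e\<^sub>0 := t)) e *\<^sub>R fundamental_flow T e) =
      (\<Sum>e\<in>- insert e\<^sub>0 T. y e *\<^sub>R fundamental_flow T e)"
    by (intro sum.cong) auto
  finally show ?thesis by (simp add: flow_section_def flow_base_def)
qed

end

section \<open>Vanishing boundary terms on a line\<close>

text \<open>Integrability of \<open>g'\<close> gives \<open>g\<close> a limit at \<open>a\<close>.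
  Were it nonzero, \<open>g t / (t - a)\<close> would dominate a multiple of
  \<open>1 / (t - a)\<close> near \<open>a\<close>, whose integral diverges logarithmically.\<close>

lemma tendsto_zero_at_right:
  fixes g g' :: "real \<Rightarrow> complex"
  assumes "a < b"
    and der: "\<And>t. a < t \<Longrightarrow> t < b \<Longrightarrow> (g has_vector_derivative g' t) (at t)"
    and g': "integrable lborel g'"
    and sing: "integrable lborel (\<lambda>t. g t / of_real (t - a))"
  shows "(g \<longlongrightarrow> 0) (at_right a)"
proof -
  \<comment> \<open>The derivative is known only between \<open>a\<close> and \<open>b\<close>, so
    the primitive is anchored at an inner point.\<close>
  define m where "m = (a + b) / 2"
  have m: "a < m" "m < b" using \<open>a < b\<close> by (auto simp: m_def)
  have g'_on: "g' integrable_on {c..d}" for c d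
    using integrable_on_lborel[OF g'] integrable_on_subinterval by blast
  define L where "L = g m - integral {a..m} g'"
  have ft: "g t = L + integral {a..t} g'" if t: "a < t" "t \<le> m" for t
  proof -
    have "(g' has_integral (g m - g t)) {t..m}"
      using t m by (intro fundamental_theorem_of_calculus) (auto intro: has_vector_derivative_at_within[OF der])
    then have eq: "integral {t..m} g' = g m - g t" by (rule integral_unique)
    have "integral {a..t} g' + integral {t..m} g' = integral {a..m} g'"
      using t g'_on by (intro Henstock_Kurzweil_Integration.integral_combine) auto
    from this[symmetric] show ?thesis by (simp add: L_def eq)
  qed
  have "continuous_on {a..m} (\<lambda>t. integral {a..t} g')"
    by (rule indefinite_integral_continuous_1[OF g'_on])
  then have "((\<lambda>t. integral {a..t} g') \<longlongrightarrow> integral {a..a} g') (at a within {a..m})"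
    using m continuous_on_def[THEN iffD1, THEN bspec, of "{a..m}" "\<lambda>t. integral {a..t} g'" a] by simp
  then have "((\<lambda>t. integral {a..t} g') \<longlongrightarrow> 0) (at_right a)"
    using m by (simp add: at_within_Icc_at_right)
  then have "((\<lambda>t. L + integral {a..t} g') \<longlongrightarrow> L) (at_right a)"
    using tendsto_add[OF tendsto_const, of _ 0 "at_right a" L] by simp
  moreover have "\<forall>\<^sub>F t in at_right a. L + integral {a..t} g' = g t"
    unfolding eventually_at_right_field using m ft by (intro exI[of _ m]) auto
  ultimately have gL: "(g \<longlongrightarrow> L) (at_right a)"
    by (rule Lim_transform_eventually)
  have "L = 0"
  proof (rule ccontr)
    assume L: "L \<noteq> 0"
    define c where "c = norm L / 2"
    have c: "c > 0" "c < norm L" using L by (auto simp: c_def)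
    have "\<forall>\<^sub>F t in at_right a. c < norm (g t)"
      using order_tendstoD(1)[OF tendsto_norm[OF gL] c(2)] .
    then obtain d where d: "d > a" "\<And>t. a < t \<Longrightarrow> t < d \<Longrightarrow> c < norm (g t)"
      unfolding eventually_at_right_field by blast
    define q where "q = (a + d) / 2"
    have q: "a < q" "q < d" using d by (auto simp: q_def)
    define K where "K = (\<integral>t. norm (g t / of_real (t - a)) \<partial>lborel)"
    have *: "c * ln (q - a) - c * ln (s - a) \<le> K" if s: "a < s" "s \<le> q" for s
    proof -
      have der: "DERIV (\<lambda>t. c * ln (t - a)) x :> c / (x - a)" if "s \<le> x" "x \<le> q" for x
        using s that by (auto intro!: derivative_eq_intros)
      have cont: "continuous_on {s..q} (\<lambda>x. c / (x - a))"
        using s by (auto intro!: continuous_intros)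
      have "has_bochner_integral lborel (\<lambda>x. c / (x - a) * indicator {s..q} x) (c * ln (q - a) - c * ln (s - a))"
        using s der cont
        by (intro has_bochner_integral_FTC_Icc_real) (auto simp: continuous_on_eq_continuous_within intro!: continuous_intros)
      then have i: "integrable lborel (\<lambda>x. c / (x - a) * indicator {s..q} x)"
        and e: "(\<integral>x. c / (x - a) * indicator {s..q} x \<partial>lborel) = c * ln (q - a) - c * ln (s - a)"
        by (auto simp: has_bochner_integral_iff)
      have "(\<integral>x. c / (x - a) * indicator {s..q} x \<partial>lborel) \<le> K"
        unfolding K_def
      proof (intro integral_mono i integrable_norm sing)
        fix x :: real
        show "c / (x - a) * indicator {s..q} x \<le> norm (g x / of_real (x - a))"
          using d(2)[of x] s q by (auto simp: indicator_def norm_divide simp del: of_real_diff intro!: divide_right_mono)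
      qed
      then show ?thesis using e by simp
    qed
    \<comment> \<open>Chosen so that \<open>c * ln (q - a) - c * ln (s - a)\<close> equals
      \<open>K + 1\<close>, above the bound \<open>K\<close>.\<close>
    define s where "s = a + (q - a) * exp (- ((K + 1) / c))"
    have "K \<ge> 0" unfolding K_def by simp
    then have "exp (- ((K + 1) / c)) \<le> 1" using c by (simp add: divide_le_0_iff)
    then have "(q - a) * exp (- ((K + 1) / c)) \<le> q - a" using q by (intro mult_left_le) auto
    then have s: "s \<le> q" unfolding s_def by linarith
    have s': "a < s" using q by (simp add: s_def)
    have "ln (s - a) = ln (q - a) - (K + 1) / c" using q by (simp add: s_def ln_mult)
    then have "c * ln (q - a) - c * ln (s - a) = c * ((K + 1) / c)" by (simp add: right_diff_distrib)
    then have "c * ln (q - a) - c * ln (s - a) = K + 1" using c by simp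
    with *[OF s' s] show False by simp
  qed
  with gL show ?thesis by simp
qed

text \<open>Limits 0 from both sides make \<open>g\<close> continuous across \<open>K\<close>, so
  \<open>g\<close> is the primitive of \<open>g'\<close> that vanishes at \<open>B\<close>. The
  integral is then the limit of \<open>g\<close> at infinity, which is 0 because \<open>g\<close> is
  integrable.\<close>

lemma integral_derivative_eq_0:
  fixes g g' :: "real \<Rightarrow> complex"
  assumes "finite K"
    and der: "\<And>t. t \<notin> K \<Longrightarrow> (g has_vector_derivative g' t) (at t)"
    and K: "\<And>k. k \<in> K \<Longrightarrow> g k = 0"
    and sing: "\<And>k. k \<in> K \<Longrightarrow> integrable lborel (\<lambda>t. g t / of_real (t - k))"
    and g: "integrable lborel g" and g': "integrable lborel g'"
    and bot: "\<And>t. t \<le> B \<Longrightarrow> g t = 0" "\<And>t. t \<le> B \<Longrightarrow> g' t = 0"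
  shows "(\<integral>t. g' t \<partial>lborel) = 0"
proof -
  have gap: "\<exists>d>0. \<forall>t. t \<noteq> k \<longrightarrow> \<bar>t - k\<bar> < d \<longrightarrow> t \<notin> K" for k
    using finite_set_avoid[OF \<open>finite K\<close>, of k] by (force simp: dist_real_def)
  have cont: "isCont g t" for t
  proof (cases "t \<in> K")
    case False
    then show ?thesis using der has_vector_derivative_continuous by blast
  next
    case True
    obtain d where d: "d > 0" "\<And>s. s \<noteq> t \<Longrightarrow> \<bar>s - t\<bar> < d \<Longrightarrow> s \<notin> K" using gap by blast
    have "(g \<longlongrightarrow> 0) (at_right t)"
      by (rule tendsto_zero_at_right[of t "t + d" g g']) (use d der g' sing True in auto)
    \<comment> \<open>The limit from the left is obtained as the limit from the right of the
      reflected function.\<close>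
    moreover have "((\<lambda>s. g (- s)) \<longlongrightarrow> 0) (at_right (- t))"
    proof (rule tendsto_zero_at_right[of _ "- t + d" _ "\<lambda>s. - g' (- s)"])
      show "((\<lambda>s. g (- s)) has_vector_derivative - g' (- s)) (at s)" if "- t < s" "s < - t + d" for s
      proof -
        have "(g has_vector_derivative g' (- s)) (at (- s))" using der d that by auto
        moreover have "(uminus has_vector_derivative (- 1 :: real)) (at s)"
          by (auto intro!: derivative_eq_intros)
        ultimately have "(g \<circ> uminus has_vector_derivative (- 1) *\<^sub>R g' (- s)) (at s)"
          by (intro vector_diff_chain_at)
        then show ?thesis by (simp add: o_def)
      qed
      show "integrable lborel (\<lambda>s. - g' (- s))"
        using lborel_integrable_real_affine[OF g', of "-1" 0] by simp
      have "integrable lborel (\<lambda>s. g (- s) / of_real (- s - t))"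
        using lborel_integrable_real_affine[OF sing[OF True], of "-1" 0] by simp
      then have "integrable lborel (\<lambda>s. - (g (- s) / of_real (- s - t)))"
        by (rule Bochner_Integration.integrable_minus)
      also have "(\<lambda>s. - (g (- s) / of_real (- s - t))) = (\<lambda>s. g (- s) / of_real (s - - t))"
        by (intro ext) (simp add: minus_divide_right)
      finally show "integrable lborel (\<lambda>s. g (- s) / of_real (s - - t))" .
    qed (use d in auto)
    then have "(g \<longlongrightarrow> 0) (at_left t)" by (simp add: at_left_minus[of t] filterlim_filtermap)
    ultimately show ?thesis
      using K[OF True] by (simp add: isCont_def filterlim_split_at)
  qed
  have "g y = (\<integral>t. indicator {..y} t *\<^sub>R g' t \<partial>lborel)" for y
  proof (cases "y \<le> B")
    case True
    then have "(\<lambda>t. indicator {..y} t *\<^sub>R g' t) = (\<lambda>t. 0)"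
      using bot(2) by (auto simp: indicator_def)
    then show ?thesis using bot(1)[OF True] by simp
  next
    case False
    have "(g' has_integral (g y - g B)) {B..y}"
      by (rule fundamental_theorem_of_calculus_interior_strong[of K])
        (use False cont der \<open>finite K\<close> in \<open>auto intro: continuous_at_imp_continuous_on\<close>)
    moreover have "(LINT t:{B..y}|lborel. g' t) = integral {B..y} g'"
      using g' by (intro set_borel_integral_eq_integral(2)) (simp add: set_integrable_def integrable_mult_indicator)
    ultimately have "g y = (\<integral>t. indicator {B..y} t *\<^sub>R g' t \<partial>lborel)"
      using bot(1)[of B] by (simp add: set_lebesgue_integral_def integral_unique)
    also have "\<dots> = (\<integral>t. indicator {..y} t *\<^sub>R g' t \<partial>lborel)"
      using bot(2) by (intro Bochner_Integration.integral_cong) (auto simp: indicator_def, meson linear)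
    finally show ?thesis .
  qed
  moreover have "((\<lambda>y. \<integral>t. indicator {..y} t *\<^sub>R g' t \<partial>lborel) \<longlongrightarrow> (\<integral>t. g' t \<partial>lborel)) at_top"
    by (rule tendsto_integral_at_top[OF _ g']) simp
  ultimately have lim: "(g \<longlongrightarrow> (\<integral>t. g' t \<partial>lborel)) at_top" by presburger
  show ?thesis
  proof (rule ccontr)
    assume L: "(\<integral>t. g' t \<partial>lborel) \<noteq> 0"
    define c where "c = norm (\<integral>t. g' t \<partial>lborel) / 2"
    have c: "c > 0" "c < norm (\<integral>t. g' t \<partial>lborel)" using L by (auto simp: c_def)
    obtain N where N: "\<And>t. t \<ge> N \<Longrightarrow> c < norm (g t)"
      using order_tendstoD(1)[OF tendsto_norm[OF lim] c(2)] unfolding eventually_at_top_linorder by blast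
    define J where "J = (\<integral>t. norm (g t) \<partial>lborel)"
    have "J \<ge> 0" unfolding J_def by simp
    \<comment> \<open>An interval of length \<open>w\<close> on which \<open>norm (g t)\<close>
      exceeds \<open>c\<close> contributes at least \<open>c * w = J + 1\<close>, more than the
      whole integral \<open>J\<close>.\<close>
    define w where "w = (J + 1) / c"
    have "integrable lborel (\<lambda>t. c * indicator {N..N + w} t)"
      by (intro integrable_mult_right integrable_real_indicator) (auto simp: emeasure_lborel_Icc_eq)
    then have "(\<integral>t. c * indicator {N..N + w} t \<partial>lborel) \<le> J"
      unfolding J_def
      using N c g by (intro integral_mono integrable_norm) (auto simp: indicator_def intro: less_imp_le)
    then have "c * w \<le> J" using \<open>J \<ge> 0\<close> c by (simp add: w_def)
    then show False using c by (simp add: w_def)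
  qed
qed

text \<open>A crude first-order Taylor remainder; the factor \<open>exp (norm w)\<close> is paid for
  by the margin of \<open>laplace_shift\<close>.\<close>

lemma norm_exp_minus_linear_le:
  fixes w :: complex
  shows "norm (exp (- w) - 1 + w) \<le> (norm w)\<^sup>2 * exp (norm w)"
proof -
  have "norm (exp (- w) - (\<Sum>k\<le>1. (- w) ^ k / fact k)) \<le> exp \<bar>Re (- w)\<bar> * norm (- w) ^ Suc 1 / fact 1"
    by (rule Taylor_exp)
  also have "\<dots> \<le> exp (norm w) * (norm w)\<^sup>2"
    by (simp add: power2_eq_square mult_right_mono abs_Re_le_cmod)
  finally have "norm (exp (- w) - (1 - w)) \<le> exp (norm w) * (norm w)\<^sup>2" by simp
  moreover have "exp (- w) - (1 - w) = exp (- w) - 1 + w" by simp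
  ultimately show ?thesis by (metis mult.commute)
qed

lemma borel_measurable_nth [measurable]: "(\<lambda>z :: real ^ 'e::finite. z $ e) \<in> borel_measurable borel"
  by (intro borel_measurable_continuous_onI continuous_intros)

section \<open>Laplace transforms\<close>

context cemetery_digraph
begin

lemma pairing_UNIV: "pairing G lam z = (\<Sum>e\<in>UNIV. lam $ e * of_real (z $ e))"
  by (simp add: pairing_def arcs_UNIV)

lemma borel_measurable_pairing [measurable]: "pairing G lam \<in> borel_measurable borel"
  unfolding pairing_UNIV [abs_def]
  by (intro borel_measurable_continuous_onI continuous_intros)

lemma pairing_add_left: "pairing G (lam + h) z = pairing G lam z + pairing G h z"
  by (simp add: pairing_def sum.distrib algebra_simps)

lemma norm_pairing_le:
  assumes "\<And>e. z $ e \<ge> 0"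
  shows "norm (pairing G h z) \<le> norm h * (\<Sum>e\<in>UNIV. z $ e)"
proof -
  have "norm (pairing G h z) \<le> (\<Sum>e\<in>UNIV. norm (h $ e * of_real (z $ e)))"
    unfolding pairing_UNIV by (rule norm_sum)
  also have "\<dots> \<le> (\<Sum>e\<in>UNIV. norm h * z $ e)"
    using assms by (intro sum_mono) (simp add: norm_mult mult_right_mono Finite_Cartesian_Product.norm_nth_le)
  finally show ?thesis by (simp add: sum_distrib_left)
qed

section \<open>Differentiation under the integral for a weight on the nonnegative orthant\<close>

context
  fixes \<mu> :: "(real ^ 'e) measure" and W :: "real ^ 'e \<Rightarrow> complex"
  assumes sets_\<mu>: "sets \<mu> = sets borel"
    and W_supp: "\<And>z e. W z \<noteq> 0 \<Longrightarrow> z $ e \<ge> 0"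
    and W_int: "\<And>lam. (\<forall>e. Re (lam $ e) > 0) \<Longrightarrow> integrable \<mu> (\<lambda>z. exp (- pairing G lam z) * W z)"
begin

text \<open>Cancelling the exponential in one integrable function recovers \<open>W\<close>; the
  vector of ones is an arbitrary admissible parameter.\<close>

lemma W_measurable: "W \<in> borel_measurable \<mu>"
proof -
  let ?l = "(\<chi> e. 1) :: complex ^ 'e"
  have "(\<lambda>z. exp (- pairing G ?l z) * W z) \<in> borel_measurable \<mu>"
    using W_int[of ?l] by (intro borel_measurable_integrable) simp
  moreover have "pairing G ?l \<in> borel_measurable \<mu>"
    using borel_measurable_pairing measurable_cong_sets[OF sets_\<mu> refl] by blast
  ultimately have "(\<lambda>z. exp (pairing G ?l z) * (exp (- pairing G ?l z) * W z)) \<in> borel_measurable \<mu>"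
    by measurable
  then show ?thesis by (simp flip: mult.assoc exp_add)
qed

lemma laplace_measurable: "(\<lambda>z. exp (- pairing G lam z) * W z) \<in> borel_measurable \<mu>"
proof -
  have [measurable]: "pairing G lam \<in> borel_measurable \<mu>"
    using borel_measurable_pairing measurable_cong_sets[OF sets_\<mu> refl] by blast
  note [measurable] = W_measurable
  show ?thesis by measurable
qed

text \<open>With \<open>r\<close> a third of the smallest real part, all real parts can be lowered
  by \<open>2 * r\<close> and stay positive. Of this margin, one half absorbs the exponential in the
  Taylor remainder and the other half its quadratic factor.\<close>

lemma laplace_shift:
  assumes "\<forall>e. Re (lam $ e) > 0"
  obtains r where "r > 0"
    "integrable \<mu> (\<lambda>z. exp (2 * r * (\<Sum>e\<in>UNIV. z $ e)) * norm (exp (- pairing G lam z) * W z))"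
proof -
  define r where "r = Min (range (\<lambda>e. Re (lam $ e))) / 3"
  have "Min (range (\<lambda>e. Re (lam $ e))) \<in> range (\<lambda>e. Re (lam $ e))" by (intro Min_in) auto
  then have r: "r > 0" using assms by (auto simp: r_def)
  have le: "3 * r \<le> Re (lam $ e)" for e
    using Min_le[of "range (\<lambda>e. Re (lam $ e))" "Re (lam $ e)"] by (simp add: r_def)
  have "2 * r < Re (lam $ e)" for e using le[of e] r by linarith
  then have i: "integrable \<mu> (\<lambda>z. exp (- pairing G (lam + (\<chi> e. - of_real (2 * r))) z) * W z)"
    by (intro W_int) simp
  have *: "pairing G (lam + (\<chi> e. - of_real (2 * r))) z = pairing G lam z - of_real (2 * r * (\<Sum>e\<in>UNIV. z $ e))" for z
    unfolding pairing_add_left by (simp add: pairing_UNIV sum_negf sum_distrib_left)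
  have "exp (- pairing G (lam + (\<chi> e. - of_real (2 * r))) z) =
      of_real (exp (2 * r * (\<Sum>e\<in>UNIV. z $ e))) * exp (- pairing G lam z)" for z
    unfolding * exp_of_real[symmetric] exp_add[symmetric] by simp
  then have "norm (exp (- pairing G (lam + (\<chi> e. - of_real (2 * r))) z) * W z) =
      exp (2 * r * (\<Sum>e\<in>UNIV. z $ e)) * norm (exp (- pairing G lam z) * W z)" for z
    by (simp add: norm_mult)
  then show thesis using integrable_norm[OF i] r that by simp
qed

text \<open>The margin dominates every coordinate by \<open>x \<le> exp x\<close>. On the support of
  \<open>W\<close> a single coordinate is at most the sum of all.\<close>

lemma laplace_moment_integrable:
  assumes "\<forall>e. Re (lam $ e) > 0"
  shows "integrable \<mu> (\<lambda>z. of_real (z $ e) * (exp (- pairing G lam z) * W z))"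
proof -
  let ?n = "\<lambda>z :: real ^ 'e. \<Sum>e\<in>UNIV. z $ e"
  obtain r where r: "r > 0"
    and i: "integrable \<mu> (\<lambda>z. exp (2 * r * ?n z) * norm (exp (- pairing G lam z) * W z))"
    using laplace_shift[OF assms] .
  have [measurable]: "(\<lambda>z. z $ e) \<in> borel_measurable \<mu>"
    using borel_measurable_nth[of e] measurable_cong_sets[OF sets_\<mu> refl] by blast
  note [measurable] = laplace_measurable
  show ?thesis
  proof (rule Bochner_Integration.integrable_bound)
    show "integrable \<mu> (\<lambda>z. (1 / (2 * r)) * (exp (2 * r * ?n z) * norm (exp (- pairing G lam z) * W z)))"
      using i by (rule integrable_mult_right)
    show "AE z in \<mu>. norm (of_real (z $ e) * (exp (- pairing G lam z) * W z)) \<le>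
        norm ((1 / (2 * r)) * (exp (2 * r * ?n z) * norm (exp (- pairing G lam z) * W z)))"
    proof (rule AE_I2)
      fix z
      show "norm (of_real (z $ e) * (exp (- pairing G lam z) * W z)) \<le>
        norm ((1 / (2 * r)) * (exp (2 * r * ?n z) * norm (exp (- pairing G lam z) * W z)))"
      proof (cases "W z = 0")
        case False
        then have z: "\<And>e. z $ e \<ge> 0" using W_supp by blast
        have "2 * r * z $ e \<le> 2 * r * ?n z"
          using z r by (intro mult_left_mono member_le_sum) auto
        also have "\<dots> \<le> exp (2 * r * ?n z)"
          using exp_ge_add_one_self[of "2 * r * ?n z"] by linarith
        finally have "z $ e \<le> 1 / (2 * r) * exp (2 * r * ?n z)"
          using r by (simp add: field_simps)
        from mult_right_mono[OF this, of "norm (exp (- pairing G lam z) * W z)"]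
        show ?thesis using z[of e] r by (simp add: norm_mult)
      qed simp
    qed
  qed measurable
qed

lemma laplace_pairing_integrable:
  assumes "\<forall>e. Re (lam $ e) > 0"
  shows "integrable \<mu> (\<lambda>z. pairing G h z * (exp (- pairing G lam z) * W z))"
    and "(\<integral>z. pairing G h z * (exp (- pairing G lam z) * W z) \<partial>\<mu>) =
      (\<Sum>e\<in>UNIV. h $ e * (\<integral>z. of_real (z $ e) * (exp (- pairing G lam z) * W z) \<partial>\<mu>))"
proof -
  have *: "pairing G h z * (exp (- pairing G lam z) * W z) =
      (\<Sum>e\<in>UNIV. h $ e * (of_real (z $ e) * (exp (- pairing G lam z) * W z)))" for z
    by (simp add: pairing_UNIV[of h] sum_distrib_right mult.assoc)
  note i = laplace_moment_integrable[OF assms]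
  show "integrable \<mu> (\<lambda>z. pairing G h z * (exp (- pairing G lam z) * W z))"
    unfolding * using i by (intro Bochner_Integration.integrable_sum integrable_mult_right)
  show "(\<integral>z. pairing G h z * (exp (- pairing G lam z) * W z) \<partial>\<mu>) =
      (\<Sum>e\<in>UNIV. h $ e * (\<integral>z. of_real (z $ e) * (exp (- pairing G lam z) * W z) \<partial>\<mu>))"
    unfolding * using i by (subst Bochner_Integration.integral_sum) auto
qed

text \<open>The remainder is bounded by the square of \<open>norm h\<close> times a fixed integrable
  function, which yields the total derivative at once.\<close>

lemma laplace_has_derivative:
  assumes lam: "\<forall>e. Re (lam $ e) > 0"
  shows "((\<lambda>lam. \<integral>z. exp (- pairing G lam z) * W z \<partial>\<mu>) has_derivative
    (\<lambda>h. - (\<integral>z. pairing G h z * (exp (- pairing G lam z) * W z) \<partial>\<mu>))) (at lam)"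
  (is "(?F has_derivative ?D) _")
proof -
  let ?n = "\<lambda>z :: real ^ 'e. \<Sum>e\<in>UNIV. z $ e"
  let ?f = "\<lambda>z. exp (- pairing G lam z) * W z"
  obtain r where r: "r > 0" and i: "integrable \<mu> (\<lambda>z. exp (2 * r * ?n z) * norm (?f z))"
    using laplace_shift[OF lam] .
  define K where "K = (\<integral>z. exp (2 * r * ?n z) * norm (?f z) \<partial>\<mu>)"
  have pos: "\<forall>e. Re ((lam + h) $ e) > 0" if "norm h < Min (range (\<lambda>e. Re (lam $ e)))" for h
  proof
    fix e
    have "\<bar>Re (h $ e)\<bar> \<le> norm h"
      using abs_Re_le_cmod[of "h $ e"] Finite_Cartesian_Product.norm_nth_le[of h e] by linarith
    moreover have "Min (range (\<lambda>e. Re (lam $ e))) \<le> Re (lam $ e)" by (intro Min_le) auto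
    ultimately show "Re ((lam + h) $ e) > 0"
      using that unfolding vector_add_component plus_complex.sel by linarith
  qed
  have Mpos: "Min (range (\<lambda>e. Re (lam $ e))) > 0"
    using lam by (subst Min_gr_iff) auto
  \<comment> \<open>The first condition bounds \<open>norm w\<close> by \<open>r * N\<close>, the
    second keeps \<open>lam + h\<close> admissible.\<close>
  have bound: "norm (?F (lam + h) - ?F lam - ?D h) \<le> (norm h)\<^sup>2 * (2 / r\<^sup>2 * K)"
    if h: "norm h \<le> r" "norm h < Min (range (\<lambda>e. Re (lam $ e)))" for h
  proof -
    note i1 = W_int[OF pos[OF h(2)]] and i2 = W_int[OF lam] and i3 = laplace_pairing_integrable(1)[OF lam, of h]
    let ?R = "\<lambda>z. exp (- pairing G (lam + h) z) * W z - ?f z + pairing G h z * ?f z"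
    have "?F (lam + h) - ?F lam - ?D h = (\<integral>z. ?R z \<partial>\<mu>)"
      using i1 i2 i3 by simp
    then have "norm (?F (lam + h) - ?F lam - ?D h) = norm (\<integral>z. ?R z \<partial>\<mu>)" by (rule arg_cong)
    also have "\<dots> \<le> (\<integral>z. norm (?R z) \<partial>\<mu>)" by (rule integral_norm_bound)
    also have "\<dots> \<le> (\<integral>z. (norm h)\<^sup>2 * (2 / r\<^sup>2) * (exp (2 * r * ?n z) * norm (?f z)) \<partial>\<mu>)"
    proof (rule integral_mono)
      show "integrable \<mu> (\<lambda>z. norm (?R z))"
        by (intro integrable_norm Bochner_Integration.integrable_add Bochner_Integration.integrable_diff i1 i2 i3)
      show "integrable \<mu> (\<lambda>z. (norm h)\<^sup>2 * (2 / r\<^sup>2) * (exp (2 * r * ?n z) * norm (?f z)))"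
        using i by (rule integrable_mult_right)
      fix z
      show "norm (?R z) \<le> (norm h)\<^sup>2 * (2 / r\<^sup>2) * (exp (2 * r * ?n z) * norm (?f z))"
      proof (cases "W z = 0")
        case False
        then have z: "\<And>e. z $ e \<ge> 0" using W_supp by blast
        define N where "N = ?n z"
        have N: "N \<ge> 0" using z by (auto simp: N_def intro: sum_nonneg)
        define w where "w = pairing G h z"
        have w: "norm w \<le> norm h * N" unfolding w_def N_def using norm_pairing_le[OF z] .
        have "norm w \<le> r * N" using w h(1) N mult_right_mono[of "norm h" r N] by linarith
        have "?R z = (exp (- w) - 1 + w) * ?f z"
          by (simp add: pairing_add_left w_def exp_add exp_minus exp_diff algebra_simps divide_inverse)
        then have "norm (?R z) = norm (exp (- w) - 1 + w) * norm (?f z)" by (simp add: norm_mult)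
        moreover have "norm (exp (- w) - 1 + w) \<le> (norm h)\<^sup>2 * (2 / r\<^sup>2) * exp (2 * r * N)"
        proof -
          have "norm (exp (- w) - 1 + w) \<le> (norm w)\<^sup>2 * exp (norm w)" by (rule norm_exp_minus_linear_le)
          also have "\<dots> \<le> (norm h * N)\<^sup>2 * exp (r * N)"
            using w \<open>norm w \<le> r * N\<close> by (intro mult_mono power_mono) auto
          also have "\<dots> = (norm h)\<^sup>2 * (1 / r\<^sup>2) * (r * N)\<^sup>2 * exp (r * N)"
            using r by (simp add: power_mult_distrib)
          \<comment> \<open>The second half of the margin is spent here, on the square of
            \<open>r * N\<close>.\<close>
          also have "\<dots> \<le> (norm h)\<^sup>2 * (1 / r\<^sup>2) * (2 * exp (r * N)) * exp (r * N)"
          proof (intro mult_right_mono mult_left_mono)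
            have "1 + r * N + (r * N)\<^sup>2 / 2 \<le> exp (r * N)"
              using r N by (intro exp_lower_Taylor_quadratic) simp
            moreover have "r * N \<ge> 0" using r N by simp
            ultimately show "(r * N)\<^sup>2 \<le> 2 * exp (r * N)" by linarith
          qed auto
          also have "\<dots> = (norm h)\<^sup>2 * (2 / r\<^sup>2) * exp (2 * r * N)"
            by (simp flip: exp_add add: mult.assoc)
          finally show ?thesis .
        qed
        ultimately have "norm (?R z) \<le> ((norm h)\<^sup>2 * (2 / r\<^sup>2) * exp (2 * r * N)) * norm (?f z)"
          by (metis mult_right_mono norm_ge_zero)
        then show ?thesis by (simp add: N_def mult.assoc)
      qed simp
    qed
    also have "\<dots> = (norm h)\<^sup>2 * (2 / r\<^sup>2 * K)" by (simp add: K_def)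
    finally show ?thesis .
  qed
  show ?thesis
    unfolding has_derivative_at
  proof
    show "bounded_linear ?D"
      unfolding laplace_pairing_integrable(2)[OF lam]
      by (intro bounded_linear_minus bounded_linear_sum bounded_linear_mult_const bounded_linear_vec_nth)
    have lim: "((\<lambda>h :: complex ^ 'e. norm h * (2 / r\<^sup>2 * K)) \<longlongrightarrow> 0) (at 0)"
      by (intro tendsto_mult_left_zero tendsto_norm_zero tendsto_ident_at)
    show "(\<lambda>h. norm (?F (lam + h) - ?F lam - ?D h) / norm h) \<midarrow>0\<rightarrow> 0"
    proof (rule Lim_null_comparison[OF _ lim])
      have "\<forall>\<^sub>F h :: complex ^ 'e in at 0. norm h < min r (Min (range (\<lambda>e. Re (lam $ e))))"
        using r Mpos by (auto simp: eventually_at intro!: exI[of _ "min r (Min (range (\<lambda>e. Re (lam $ e))))"])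
      moreover have "\<forall>\<^sub>F h :: complex ^ 'e in at 0. h \<noteq> 0" by (simp add: eventually_at_filter)
      ultimately show "\<forall>\<^sub>F h in at 0. norm (norm (?F (lam + h) - ?F lam - ?D h) / norm h) \<le> norm h * (2 / r\<^sup>2 * K)"
      proof eventually_elim
        case (elim h)
        then show ?case
          using bound[of h] by (simp add: divide_le_eq power2_eq_square mult_ac)
      qed
    qed
  qed
qed

end

section \<open>Weights on the positive orthant and their integrals along lines\<close>

definition log_weight :: "complex ^ 'e \<Rightarrow> ('e \<Rightarrow> real) \<Rightarrow> real ^ 'e \<Rightarrow> complex" where
  "log_weight lam \<beta> z =
     (if \<forall>e. z $ e > 0 then exp (of_real (\<Sum>e\<in>UNIV. \<beta> e * ln (z $ e)) - pairing G lam z) else 0)"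

text \<open>The factor before the weight is its logarithmic derivative along \<open>c\<close>, so
  the integrand is a derivative except where the line meets a hyperplane \<open>z $ e = 0\<close>
  with \<open>c $ e \<noteq> 0\<close>. The condition at \<open>e\<^sub>0\<close> makes the weight
  vanish on a left half-line.\<close>

lemma integral_log_weight_line:
  fixes z\<^sub>0 c :: "real ^ 'e"
  assumes c: "c $ e\<^sub>0 = 1"
    and g: "integrable lborel (\<lambda>t. log_weight lam \<beta> (z\<^sub>0 + t *\<^sub>R c))"
    and ge: "\<And>e. c $ e \<noteq> 0 \<Longrightarrow>
      integrable lborel (\<lambda>t. log_weight lam \<beta> (z\<^sub>0 + t *\<^sub>R c) / of_real ((z\<^sub>0 + t *\<^sub>R c) $ e))"
  shows "(\<integral>t. ((\<Sum>e\<in>{e. c $ e \<noteq> 0}. of_real (c $ e * \<beta> e) / of_real ((z\<^sub>0 + t *\<^sub>R c) $ e)) - pairing G lam c) *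
    log_weight lam \<beta> (z\<^sub>0 + t *\<^sub>R c) \<partial>lborel) = 0"
proof -
  define S where "S = {e. c $ e \<noteq> 0}"
  define Z where "Z t = z\<^sub>0 + t *\<^sub>R c" for t
  define q where "q t = ((\<Sum>e\<in>S. of_real (c $ e * \<beta> e) / of_real (Z t $ e)) - pairing G lam c) * log_weight lam \<beta> (Z t)" for t
  have Z_nth: "Z t $ e = z\<^sub>0 $ e + t * c $ e" for t e by (simp add: Z_def)
  let ?k = "\<lambda>e. - z\<^sub>0 $ e / c $ e"
  have Z_k: "Z t $ e = c $ e * (t - ?k e)" if "c $ e \<noteq> 0" for t e
    using that by (simp add: Z_nth field_simps)
  have cong: "(f has_vector_derivative D) (at t)"
    if "\<forall>\<^sub>F s in nhds t. f s = h s" "(h has_vector_derivative D) (at t)" for f h :: "real \<Rightarrow> complex" and D t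
    using that has_vector_derivative_cong_ev[of UNIV f h t D] eventually_nhds_x_imp_x[of "\<lambda>s. f s = h s" t] by simp
  have "(\<integral>t. q t \<partial>lborel) = 0"
  proof (rule integral_derivative_eq_0[where g = "\<lambda>t. log_weight lam \<beta> (Z t)" and K = "?k ` S" and B = "?k e\<^sub>0"])
    show "((\<lambda>t. log_weight lam \<beta> (Z t)) has_vector_derivative q t) (at t)" if t: "t \<notin> ?k ` S" for t
    proof (cases "\<forall>e. Z t $ e > 0")
      case True
      let ?E = "\<lambda>t. of_real (\<Sum>e\<in>UNIV. \<beta> e * ln (Z t $ e)) - pairing G lam (Z t)"
      have "\<forall>\<^sub>F s in nhds t. Z s $ e > 0" for e
      proof -
        have "isCont (\<lambda>s. Z s $ e) t" unfolding Z_nth by (intro continuous_intros)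
        then have "((\<lambda>s. Z s $ e) \<longlongrightarrow> Z t $ e) (nhds t)" by (simp add: isCont_def tendsto_nhds_iff)
        then show ?thesis using True by (intro order_tendstoD(1)) auto
      qed
      then have "\<forall>\<^sub>F s in nhds t. \<forall>e. Z s $ e > 0" by (rule eventually_all_finite)
      then have ev: "\<forall>\<^sub>F s in nhds t. log_weight lam \<beta> (Z s) = exp (?E s)"
        by eventually_elim (simp add: log_weight_def)
      have "((\<lambda>t. \<Sum>e\<in>UNIV. \<beta> e * ln (Z t $ e)) has_field_derivative (\<Sum>e\<in>UNIV. \<beta> e * (c $ e / Z t $ e))) (at t)"
        using True by (auto simp: Z_nth intro!: derivative_eq_intros sum.cong)
      then have d1: "((\<lambda>t. complex_of_real (\<Sum>e\<in>UNIV. \<beta> e * ln (Z t $ e))) has_vector_derivative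
          of_real (\<Sum>e\<in>UNIV. \<beta> e * (c $ e / Z t $ e))) (at t)"
        by (rule has_vector_derivative_of_real)
      have "((\<lambda>t. pairing G lam z\<^sub>0 + of_real t * pairing G lam c) has_vector_derivative pairing G lam c) (at t)"
        by (auto intro!: derivative_eq_intros)
      then have d2: "((\<lambda>t. pairing G lam (Z t)) has_vector_derivative pairing G lam c) (at t)"
        by (simp add: Z_def pairing_add pairing_scaleR)
      have "(exp \<circ> ?E has_vector_derivative
          (of_real (\<Sum>e\<in>UNIV. \<beta> e * (c $ e / Z t $ e)) - pairing G lam c) * exp (?E t)) (at t)"
        by (intro field_vector_diff_chain_at has_vector_derivative_diff d1 d2 DERIV_exp)
      then have "((\<lambda>s. log_weight lam \<beta> (Z s)) has_vector_derivative
          (of_real (\<Sum>e\<in>UNIV. \<beta> e * (c $ e / Z t $ e)) - pairing G lam c) * exp (?E t)) (at t)"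
        by (intro cong[OF ev]) (simp add: o_def)
      moreover have "(\<Sum>e\<in>UNIV. \<beta> e * (c $ e / Z t $ e)) = (\<Sum>e\<in>S. c $ e * \<beta> e / Z t $ e)"
        by (rule sum.mono_neutral_cong_right) (auto simp: S_def)
      then have "complex_of_real (\<Sum>e\<in>UNIV. \<beta> e * (c $ e / Z t $ e)) =
          (\<Sum>e\<in>S. of_real (c $ e * \<beta> e) / of_real (Z t $ e))"
        by simp
      moreover have "log_weight lam \<beta> (Z t) = exp (?E t)"
        using True by (simp add: log_weight_def)
      ultimately show ?thesis by (simp only: q_def)
    next
      case False
      \<comment> \<open>Off the exceptional points a nonpositive coordinate is either constant along
        the line or strictly negative, so the weight vanishes near \<open>t\<close>.\<close>
      then obtain e where e: "Z t $ e \<le> 0" by (auto simp: not_less)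
      have "\<forall>\<^sub>F s in nhds t. Z s $ e \<le> 0"
      proof (cases "c $ e = 0")
        case True
        then show ?thesis using e by (simp add: Z_nth)
      next
        case False
        then have "t \<noteq> ?k e" using t by (auto simp: S_def)
        then have "Z t $ e \<noteq> 0" using False Z_k[of e t] by simp
        moreover have "isCont (\<lambda>s. Z s $ e) t" unfolding Z_nth by (intro continuous_intros)
        then have "((\<lambda>s. Z s $ e) \<longlongrightarrow> Z t $ e) (nhds t)" by (simp add: isCont_def tendsto_nhds_iff)
        ultimately have "\<forall>\<^sub>F s in nhds t. Z s $ e < 0" using e by (intro order_tendstoD(2)) auto
        then show ?thesis by eventually_elim simp
      qed
      then have "\<forall>\<^sub>F s in nhds t. log_weight lam \<beta> (Z s) = 0"
        by eventually_elim (auto simp: log_weight_def not_less)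
      then have "((\<lambda>t. log_weight lam \<beta> (Z t)) has_vector_derivative 0) (at t)"
        by (rule cong) (rule has_vector_derivative_const)
      moreover have "q t = 0" using False by (auto simp: q_def log_weight_def)
      ultimately show ?thesis by simp
    qed
    show "log_weight lam \<beta> (Z k) = 0" if k: "k \<in> ?k ` S" for k
    proof -
      obtain e where "c $ e \<noteq> 0" "k = ?k e" using k by (auto simp: S_def)
      then have "Z k $ e = 0" by (simp add: Z_k)
      then show ?thesis unfolding log_weight_def by (metis less_irrefl)
    qed
    show ik: "integrable lborel (\<lambda>t. log_weight lam \<beta> (Z t) / of_real (t - k))" if "k \<in> ?k ` S" for k
    proof -
      obtain e where e: "c $ e \<noteq> 0" "k = ?k e" using \<open>k \<in> ?k ` S\<close> by (auto simp: S_def)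
      \<comment> \<open>On the line, \<open>t - k\<close> is \<open>Z t $ e\<close> divided by the
        slope \<open>c $ e\<close>.\<close>
      have "integrable lborel (\<lambda>t. of_real (c $ e) * (log_weight lam \<beta> (Z t) / of_real (Z t $ e)))"
        using ge[OF e(1)] by (intro integrable_mult_right) (simp add: Z_def)
      also have "(\<lambda>t. of_real (c $ e) * (log_weight lam \<beta> (Z t) / of_real (Z t $ e))) =
          (\<lambda>t. log_weight lam \<beta> (Z t) / of_real (t - k))"
        unfolding Z_k[OF e(1)] e(2)[symmetric] using e(1) by (intro ext) simp
      finally show ?thesis .
    qed
    show g': "integrable lborel (\<lambda>t. log_weight lam \<beta> (Z t))" using g by (simp add: Z_def)
    have "integrable lborel (\<lambda>t. (\<Sum>e\<in>S. of_real (c $ e * \<beta> e) * (log_weight lam \<beta> (Z t) / of_real (Z t $ e))) -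
        pairing G lam c * log_weight lam \<beta> (Z t))"
      using ge g' by (intro Bochner_Integration.integrable_diff Bochner_Integration.integrable_sum integrable_mult_right)
        (auto simp: Z_def S_def)
    then show "integrable lborel q"
      by (simp add: q_def[abs_def] left_diff_distrib sum_distrib_right)
    show "log_weight lam \<beta> (Z t) = 0" if "t \<le> ?k e\<^sub>0" for t
      using that c by (auto simp: log_weight_def Z_nth not_less intro!: exI[of _ e\<^sub>0])
    then show "q t = 0" if "t \<le> ?k e\<^sub>0" for t using that by (simp add: q_def)
  qed auto
  then show ?thesis by (simp add: q_def S_def Z_def)
qed

end

section \<open>The integrals in the charts of spanning trees\<close>

lemma borel_measurable_coordinate:
  "e \<in> I \<Longrightarrow> (\<lambda>y. y e) \<in> borel_measurable (Pi\<^sub>M I (\<lambda>_. lborel :: real measure))"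
  using measurable_component_singleton[of e I "\<lambda>_. lborel :: real measure"] by simp

lemma frechet_derivative_signed_form:
  fixes lam :: "complex ^ 'e::finite"
  shows "frechet_derivative (signed_form s A) (at lam) = signed_form s A"
proof -
  have "bounded_linear (signed_form s A :: complex ^ 'e \<Rightarrow> complex)"
    unfolding signed_form_def [abs_def]
    by (intro bounded_linear_sum bounded_linear_const_mult bounded_linear_vec_nth)
  then show ?thesis
    by (metis bounded_linear_imp_has_derivative frechet_derivative_at)
qed

context cemetery_digraph
begin

text \<open>The positive measure of the chart of \<open>T\<close>, carried over to the space of
  flows, where the measures of different charts can be compared.\<close>

definition flow_measure :: "'e set \<Rightarrow> (real ^ 'e) measure" where
  "flow_measure T = distr (Pi\<^sub>M (- T) (\<lambda>_. lborel)) borel (flow_section T)"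

lemma sets_flow_measure [simp, measurable_cong]: "sets (flow_measure T) = sets borel"
  by (simp add: flow_measure_def)

lemma borel_measurable_flow_section [measurable]:
  "flow_section T \<in> borel_measurable (Pi\<^sub>M (- T) (\<lambda>_. lborel))"
  unfolding flow_section_def [abs_def]
  by (intro borel_measurable_add borel_measurable_sum borel_measurable_scaleR borel_measurable_const
      borel_measurable_coordinate)

lemma borel_measurable_flow_base [measurable]:
  "flow_base T e\<^sub>0 \<in> borel_measurable (Pi\<^sub>M (- insert e\<^sub>0 T) (\<lambda>_. lborel))"
  unfolding flow_base_def [abs_def]
  by (intro borel_measurable_add borel_measurable_sum borel_measurable_scaleR borel_measurable_const
      borel_measurable_coordinate)

lemma nn_integral_flow_measure:
  assumes e\<^sub>0: "e\<^sub>0 \<notin> T" and f [measurable]: "f \<in> borel_measurable borel"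
  shows "(\<integral>\<^sup>+z. f z \<partial>flow_measure T) =
    (\<integral>\<^sup>+y. \<integral>\<^sup>+t. f (flow_section T (y(e\<^sub>0 := t))) \<partial>lborel \<partial>Pi\<^sub>M (- insert e\<^sub>0 T) (\<lambda>_. lborel))"
proof -
  interpret product_sigma_finite "\<lambda>_ :: 'e. lborel :: real measure" ..
  have T: "insert e\<^sub>0 (- insert e\<^sub>0 T) = - T" using e\<^sub>0 by auto
  have "(\<integral>\<^sup>+z. f z \<partial>flow_measure T) = (\<integral>\<^sup>+y. f (flow_section T y) \<partial>Pi\<^sub>M (- T) (\<lambda>_. lborel))"
    unfolding flow_measure_def by (intro nn_integral_distr) auto
  also have "\<dots> = (\<integral>\<^sup>+y. \<integral>\<^sup>+t. f (flow_section T (y(e\<^sub>0 := t))) \<partial>lborel \<partial>Pi\<^sub>M (- insert e\<^sub>0 T) (\<lambda>_. lborel))"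
    by (subst T[symmetric], subst product_nn_integral_insert) (auto simp: T)
  finally show ?thesis .
qed

text \<open>Fubini along the lines in the direction of the fundamental cycle, stated as the image of
  a product measure so that it serves Bochner integrals.\<close>

lemma flow_measure_pair:
  assumes e\<^sub>0: "e\<^sub>0 \<notin> T"
  shows "flow_measure T = distr (Pi\<^sub>M (- insert e\<^sub>0 T) (\<lambda>_. lborel) \<Otimes>\<^sub>M lborel) borel
    (\<lambda>(y, t). flow_base T e\<^sub>0 y + t *\<^sub>R fundamental_flow T e\<^sub>0)" (is "_ = distr (?P \<Otimes>\<^sub>M _) _ ?\<Phi>")
proof (rule measure_eqI)
  fix A assume "A \<in> sets (flow_measure T)"
  then have A [measurable]: "A \<in> sets borel" by simp
  have "emeasure (flow_measure T) A = (\<integral>\<^sup>+z. indicator A z \<partial>flow_measure T)" by simp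
  also have "\<dots> = (\<integral>\<^sup>+y. \<integral>\<^sup>+t. indicator A (?\<Phi> (y, t)) \<partial>lborel \<partial>?P)"
    by (simp only: nn_integral_flow_measure[OF e\<^sub>0 borel_measurable_indicator[OF A]] flow_section_upd[OF e\<^sub>0]
        prod.case)
  also have "\<dots> = (\<integral>\<^sup>+p. indicator A (?\<Phi> p) \<partial>(?P \<Otimes>\<^sub>M lborel))"
    by (intro lborel.nn_integral_fst) measurable
  also have "\<dots> = (\<integral>\<^sup>+z. indicator A z \<partial>distr (?P \<Otimes>\<^sub>M lborel) borel ?\<Phi>)"
    by (intro nn_integral_distr[symmetric]) measurable
  also have "\<dots> = emeasure (distr (?P \<Otimes>\<^sub>M lborel) borel ?\<Phi>) A" by simp
  finally show "emeasure (flow_measure T) A = emeasure (distr (?P \<Otimes>\<^sub>M lborel) borel ?\<Phi>) A" .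
qed simp

lemma fundamental_flow_cycle_nth:
  assumes "T \<in> spanning_trees G" "e\<^sub>0 \<notin> T" "simple_cycle G C" "C \<subseteq> insert e\<^sub>0 T" "cycle_orientation G C s"
  shows "fundamental_flow T e\<^sub>0 $ e = (if e \<in> C then s e\<^sub>0 * s e else 0)"
  by (simp add: fundamental_flow_eq[OF assms])

text \<open>Along the fundamental cycle the coordinates \<open>z\<^sub>e\<close> and \<open>z\<^sub>e\<^sub>0\<close> differ by an affine map of slope \<open>\<plusminus>1\<close>.\<close>

lemma flow_measure_exchange:
  assumes T: "T \<in> spanning_trees G" and e\<^sub>0: "e\<^sub>0 \<notin> T"
    and C: "simple_cycle G C" "C \<subseteq> insert e\<^sub>0 T" and e: "e \<in> C"
  shows "flow_measure (insert e\<^sub>0 T - {e}) = flow_measure T"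
proof (cases "e = e\<^sub>0")
  case True
  then show ?thesis using e\<^sub>0 by (simp add: insert_Diff_if)
next
  case False
  let ?T' = "insert e\<^sub>0 T - {e}"
  have T': "?T' \<in> spanning_trees G" by (rule exchange_spanning_tree[OF T C e])
  have e': "e \<notin> ?T'" "insert e ?T' = insert e\<^sub>0 T" using e C(2) by auto
  obtain s where s: "cycle_orientation G C s" using orientation_exists C by blast
  define u where "u = fundamental_flow T e\<^sub>0 $ e"
  have e\<^sub>0C: "e\<^sub>0 \<in> C" using tree_acyclic[OF T C(1)] C(2) by auto
  have u: "\<bar>u\<bar> = 1"
    using cycle_orientation_sign[OF s e] cycle_orientation_sign[OF s e\<^sub>0C] e
    by (auto simp: u_def fundamental_flow_cycle_nth[OF T e\<^sub>0 C s])
  show ?thesis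
  proof (rule measure_eqI)
    fix A assume "A \<in> sets (flow_measure ?T')"
    then have A [measurable]: "A \<in> sets borel" by simp
    have *: "(\<integral>\<^sup>+x. indicator A (flow_section ?T' (y(e := x))) \<partial>lborel) =
        (\<integral>\<^sup>+t. indicator A (flow_section T (y(e\<^sub>0 := t))) \<partial>lborel)" (is "?L = ?R") for y
    proof -
      define a where "a = flow_base T e\<^sub>0 y $ e"
      \<comment> \<open>Coordinates outside both trees are fixed along the line, so \<open>y\<close>
        serves both charts and only the parameters \<open>t\<close> and \<open>a + u * t\<close>
        have to be matched.\<close>
      have "flow_section ?T' (y(e := a + u * t)) = flow_section T (y(e\<^sub>0 := t))" for t
      proof (rule flow_section_unique[OF T' flow_section_unit[OF T]])
        fix i assume i: "i \<notin> ?T'"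
        show "flow_section T (y(e\<^sub>0 := t)) $ i = (y(e := a + u * t)) i"
        proof (cases "i = e")
          case True
          then show ?thesis by (simp add: flow_section_upd[OF e\<^sub>0] a_def u_def)
        next
          case False
          then have "i \<notin> T" "i \<noteq> e\<^sub>0" using i by auto
          then show ?thesis using False by (simp add: flow_section_nth[OF T])
        qed
      qed
      moreover have "?L = ennreal \<bar>u\<bar> * (\<integral>\<^sup>+t. indicator A (flow_section ?T' (y(e := a + u * t))) \<partial>lborel)"
        using u by (intro nn_integral_real_affine) (auto simp: flow_section_upd[OF e'(1)])
      ultimately show ?thesis using u by simp
    qed
    have "emeasure (flow_measure ?T') A = (\<integral>\<^sup>+z. indicator A z \<partial>flow_measure ?T')" by simp
    also have "\<dots> = (\<integral>\<^sup>+z. indicator A z \<partial>flow_measure T)"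
      by (simp only: nn_integral_flow_measure[OF e'(1) borel_measurable_indicator[OF A]]
          nn_integral_flow_measure[OF e\<^sub>0 borel_measurable_indicator[OF A]] e'(2) *)
    also have "\<dots> = emeasure (flow_measure T) A" by simp
    finally show "emeasure (flow_measure ?T') A = emeasure (flow_measure T) A" .
  qed simp
qed

section \<open>Tree integrals as integrals of weights over the space of flows\<close>

lemma borel_measurable_log_weight [measurable]: "log_weight lam \<beta> \<in> borel_measurable borel"
  unfolding log_weight_def [abs_def] by measurable

lemma log_weight_split: "log_weight lam \<beta> z = exp (- pairing G lam z) * log_weight 0 \<beta> z"
  by (simp add: log_weight_def pairing_def exp_diff exp_minus divide_inverse)

lemma log_weight_raise:
  "log_weight lam (\<beta>(e := \<beta> e + 1)) z = of_real (z $ e) * log_weight lam \<beta> z"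
proof (cases "\<forall>e. z $ e > 0")
  case True
  have "(\<Sum>i\<in>UNIV. (\<beta>(e := \<beta> e + 1)) i * ln (z $ i)) =
      (\<Sum>i\<in>UNIV. \<beta> i * ln (z $ i) + (if i = e then ln (z $ e) else 0))"
    by (intro sum.cong) (auto simp: distrib_right)
  then have "(\<Sum>i\<in>UNIV. (\<beta>(e := \<beta> e + 1)) i * ln (z $ i)) = (\<Sum>i\<in>UNIV. \<beta> i * ln (z $ i)) + ln (z $ e)"
    by (simp add: sum.distrib)
  moreover have "exp (complex_of_real (ln (z $ e))) = of_real (z $ e)"
    using True by (simp add: exp_of_real)
  ultimately show ?thesis
    using True by (simp add: log_weight_def exp_add exp_diff)
qed (auto simp: log_weight_def)

text \<open>The factor \<open>1 / z $ e\<close> of the form lowers the exponent off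
  \<open>T\<close>. Raising the exponent at \<open>e\<^sub>0\<close> and lowering it at
  \<open>e\<close> thus passes to the exchanged tree.\<close>

definition tree_exponent :: "('e \<Rightarrow> real) \<Rightarrow> 'e set \<Rightarrow> 'e \<Rightarrow> real" where
  "tree_exponent \<alpha> T e = (if e \<in> T then \<alpha> e else \<alpha> e - 1)"

lemma tree_integrand_eq:
  assumes z: "\<And>e. z $ e > 0"
  shows "tree_integrand G \<alpha> T lam z = log_weight lam (tree_exponent \<alpha> T) z"
proof -
  have "(\<Prod>e\<in>UNIV. (z $ e) powr \<alpha> e) * (\<Prod>e\<in>- T. 1 / z $ e) =
      exp (\<Sum>e\<in>UNIV. \<alpha> e * ln (z $ e)) * exp (\<Sum>e\<in>- T. - ln (z $ e))"
    using z by (simp add: exp_sum powr_def exp_minus less_imp_neq[THEN not_sym] inverse_eq_divide)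
  also have "\<dots> = exp ((\<Sum>e\<in>UNIV. \<alpha> e * ln (z $ e)) + (\<Sum>e\<in>UNIV. if e \<in> - T then - ln (z $ e) else 0))"
    by (simp add: exp_add sum.If_cases Compl_eq)
  also have "(\<Sum>e\<in>UNIV. \<alpha> e * ln (z $ e)) + (\<Sum>e\<in>UNIV. if e \<in> - T then - ln (z $ e) else 0) =
      (\<Sum>e\<in>UNIV. tree_exponent \<alpha> T e * ln (z $ e))"
    unfolding sum.distrib[symmetric] by (intro sum.cong) (auto simp: tree_exponent_def left_diff_distrib)
  finally have "tree_integrand G \<alpha> T lam z =
      exp (- pairing G lam z) * of_real (exp (\<Sum>e\<in>UNIV. tree_exponent \<alpha> T e * ln (z $ e)))"
    unfolding tree_integrand_def arcs_UNIV Compl_eq_Diff_UNIV mult.assoc of_real_mult[symmetric] by simp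
  then show ?thesis
    using z by (simp add: log_weight_def exp_diff exp_minus divide_inverse mult.commute flip: exp_of_real)
qed

text \<open>The value 0 of \<open>log_weight\<close> outside the positive orthant replaces the
  indicator: \<open>y\<close> lies in the image of the chart exactly when its flow is
  positive.\<close>

lemma tree_chart_section:
  assumes T: "T \<in> spanning_trees G" and y: "y \<in> space (Pi\<^sub>M (- T) (\<lambda>_. lborel :: real measure))"
  shows "indicator (tree_chart G T ` positive_flows G \<delta> x\<^sub>0) y *\<^sub>R
      tree_integrand G \<alpha> T lam (inv_into (positive_flows G \<delta> x\<^sub>0) (tree_chart G T) y) =
    log_weight lam (tree_exponent \<alpha> T) (flow_section T y)"
proof -
  let ?P = "positive_flows G \<delta> x\<^sub>0"
  have chart: "tree_chart G T (flow_section T y) = y"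
    using y by (auto simp: tree_chart_def arcs_UNIV Compl_eq_Diff_UNIV[symmetric] flow_section_nth[OF T]
        space_PiM PiE_def extensional_def fun_eq_iff)
  have section': "flow_section T (tree_chart G T z) = z" if "z \<in> ?P" for z
    using that by (intro flow_section_unique[OF T]) (auto simp: positive_flows_def tree_chart_def)
  have inj: "inj_on (tree_chart G T) ?P" by (rule inj_on_inverseI[of _ "flow_section T"]) (rule section')
  show ?thesis
  proof (cases "flow_section T y \<in> ?P")
    case True
    then have "inv_into ?P (tree_chart G T) y = flow_section T y"
      using inv_into_f_f[OF inj True] chart by simp
    moreover have "y \<in> tree_chart G T ` ?P" using True chart by force
    moreover have "\<And>e. flow_section T y $ e > 0" using True by (simp add: positive_flows_def)
    ultimately show ?thesis by (simp add: tree_integrand_eq)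
  next
    case False
    then have "y \<notin> tree_chart G T ` ?P" using section' by auto
    moreover have "\<not> (\<forall>e. flow_section T y $ e > 0)"
      using False flow_section_unit[OF T, of y] by (auto simp: positive_flows_def)
    ultimately show ?thesis by (auto simp: log_weight_def)
  qed
qed

lemma tree_integral_eq:
  assumes T: "T \<in> spanning_trees G"
  shows "tree_integral G \<delta> x\<^sub>0 \<alpha> T lam = (\<integral>z. log_weight lam (tree_exponent \<alpha> T) z \<partial>flow_measure T)"
proof -
  have "tree_integral G \<delta> x\<^sub>0 \<alpha> T lam =
      (\<integral>y. log_weight lam (tree_exponent \<alpha> T) (flow_section T y) \<partial>Pi\<^sub>M (- T) (\<lambda>_. lborel))"
    unfolding tree_integral_def set_lebesgue_integral_def arcs_UNIV Compl_eq_Diff_UNIV[symmetric]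
    by (intro Bochner_Integration.integral_cong tree_chart_section[OF T] refl)
  then show ?thesis by (simp add: flow_measure_def integral_distr)
qed

lemma tree_integral_exists_iff:
  assumes T: "T \<in> spanning_trees G"
  shows "tree_integral_exists G \<delta> x\<^sub>0 \<alpha> T lam \<longleftrightarrow> integrable (flow_measure T) (log_weight lam (tree_exponent \<alpha> T))"
proof -
  have "tree_integral_exists G \<delta> x\<^sub>0 \<alpha> T lam \<longleftrightarrow>
      integrable (Pi\<^sub>M (- T) (\<lambda>_. lborel)) (\<lambda>y. log_weight lam (tree_exponent \<alpha> T) (flow_section T y))"
    unfolding tree_integral_exists_def set_integrable_def arcs_UNIV Compl_eq_Diff_UNIV[symmetric]
    by (intro Bochner_Integration.integrable_cong tree_chart_section[OF T] refl)
  then show ?thesis by (simp add: flow_measure_def integrable_distr_eq)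
qed

text \<open>Integration by parts in the direction of a fundamental cycle. By Fubini almost every
  line inherits the integrability hypotheses, so the derivative \<open>q\<close> integrates to 0
  line by line.\<close>

lemma flow_measure_derivative:
  assumes T: "T \<in> spanning_trees G" and e\<^sub>0: "e\<^sub>0 \<notin> T"
    and g: "integrable (flow_measure T) (log_weight lam \<beta>)"
    and ge: "\<And>e. fundamental_flow T e\<^sub>0 $ e \<noteq> 0 \<Longrightarrow>
      integrable (flow_measure T) (\<lambda>z. log_weight lam \<beta> z / of_real (z $ e))"
  shows "(\<Sum>e\<in>{e. fundamental_flow T e\<^sub>0 $ e \<noteq> 0}. of_real (fundamental_flow T e\<^sub>0 $ e * \<beta> e) *
      (\<integral>z. log_weight lam \<beta> z / of_real (z $ e) \<partial>flow_measure T)) =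
    pairing G lam (fundamental_flow T e\<^sub>0) * (\<integral>z. log_weight lam \<beta> z \<partial>flow_measure T)"
proof -
  let ?c = "fundamental_flow T e\<^sub>0"
  let ?S = "{e. ?c $ e \<noteq> 0}"
  let ?P = "Pi\<^sub>M (- insert e\<^sub>0 T) (\<lambda>_. lborel :: real measure)"
  let ?\<Phi> = "\<lambda>(y, t). flow_base T e\<^sub>0 y + t *\<^sub>R ?c"
  define q where "q z = ((\<Sum>e\<in>?S. of_real (?c $ e * \<beta> e) / of_real (z $ e)) - pairing G lam ?c) * log_weight lam \<beta> z" for z
  have q: "q z = (\<Sum>e\<in>?S. of_real (?c $ e * \<beta> e) * (log_weight lam \<beta> z / of_real (z $ e))) -
      pairing G lam ?c * log_weight lam \<beta> z" for z
    by (simp add: q_def left_diff_distrib sum_distrib_right)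
  have i1: "integrable (flow_measure T) (\<lambda>z. of_real (?c $ e * \<beta> e) * (log_weight lam \<beta> z / of_real (z $ e)))"
    if "e \<in> ?S" for e
    using that by (intro integrable_mult_right ge) simp
  have i2: "integrable (flow_measure T) (\<lambda>z. pairing G lam ?c * log_weight lam \<beta> z)"
    by (intro integrable_mult_right g)
  note i3 = Bochner_Integration.integrable_sum[OF i1]
  have q_int: "integrable (flow_measure T) q"
    unfolding q[abs_def] by (rule Bochner_Integration.integrable_diff[OF i3 i2])
  interpret product_sigma_finite "\<lambda>_ :: 'e. lborel :: real measure" ..
  interpret P: sigma_finite_measure ?P by (rule sigma_finite) simp
  interpret P: pair_sigma_finite ?P lborel ..
  have \<Phi> [measurable]: "?\<Phi> \<in> borel_measurable (?P \<Otimes>\<^sub>M lborel)" by measurable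
  have pull: "integrable (?P \<Otimes>\<^sub>M lborel) (\<lambda>p. f (?\<Phi> p))" if "integrable (flow_measure T) f" for f :: "_ \<Rightarrow> complex"
    using that unfolding flow_measure_pair[OF e\<^sub>0] by (rule integrable_distr[OF \<Phi>])
  have slice: "AE y in ?P. integrable lborel (\<lambda>t. f (flow_base T e\<^sub>0 y + t *\<^sub>R ?c))"
    if "integrable (flow_measure T) f" for f :: "_ \<Rightarrow> complex"
    using P.AE_integrable_fst'[OF pull[OF that]] by simp
  have "AE y in ?P. \<forall>e\<in>?S. integrable lborel (\<lambda>t. log_weight lam \<beta> (flow_base T e\<^sub>0 y + t *\<^sub>R ?c) /
      of_real ((flow_base T e\<^sub>0 y + t *\<^sub>R ?c) $ e))"
    by (intro AE_finite_allI finite slice ge) simp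
  with slice[OF g] have "AE y in ?P. (\<integral>t. q (flow_base T e\<^sub>0 y + t *\<^sub>R ?c) \<partial>lborel) = 0"
  proof eventually_elim
    case (elim y)
    then show ?case
      unfolding q_def by (intro integral_log_weight_line[OF fundamental_flow_base[OF T e\<^sub>0]]) auto
  qed
  then have "(\<integral>y. \<integral>t. q (flow_base T e\<^sub>0 y + t *\<^sub>R ?c) \<partial>lborel \<partial>?P) = 0"
    by (rule integral_eq_zero_AE)
  moreover have "(\<integral>z. q z \<partial>flow_measure T) = (\<integral>p. q (?\<Phi> p) \<partial>(?P \<Otimes>\<^sub>M lborel))"
    using borel_measurable_integrable[OF q_int]
    unfolding flow_measure_pair[OF e\<^sub>0] by (intro integral_distr) auto
  moreover have "\<dots> = (\<integral>y. \<integral>t. q (flow_base T e\<^sub>0 y + t *\<^sub>R ?c) \<partial>lborel \<partial>?P)"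
    using P.integral_fst'[OF pull[OF q_int]] by simp
  ultimately have "(\<integral>z. q z \<partial>flow_measure T) = 0" by simp
  moreover have "(\<integral>z. q z \<partial>flow_measure T) =
      (\<integral>z. (\<Sum>e\<in>?S. of_real (?c $ e * \<beta> e) * (log_weight lam \<beta> z / of_real (z $ e))) \<partial>flow_measure T) -
      (\<integral>z. pairing G lam ?c * log_weight lam \<beta> z \<partial>flow_measure T)"
    unfolding q by (rule Bochner_Integration.integral_diff) (rule i3, assumption, rule i2)
  moreover have "(\<integral>z. (\<Sum>e\<in>?S. of_real (?c $ e * \<beta> e) * (log_weight lam \<beta> z / of_real (z $ e))) \<partial>flow_measure T) =
      (\<Sum>e\<in>?S. \<integral>z. of_real (?c $ e * \<beta> e) * (log_weight lam \<beta> z / of_real (z $ e)) \<partial>flow_measure T)"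
    by (rule Bochner_Integration.integral_sum) (rule i1)
  ultimately show ?thesis by (simp only: integral_mult_right_zero) simp
qed

section \<open>The differential system\<close>

context
  fixes \<alpha> :: "'e \<Rightarrow> real"
  assumes well_defined: "\<And>T (lam :: complex ^ 'e). T \<in> spanning_trees G \<Longrightarrow> (\<forall>e\<in>arcs G. Re (lam $ e) > 0) \<Longrightarrow>
    tree_integral_exists G \<delta> x\<^sub>0 \<alpha> T lam"
begin

abbreviation I :: "'e set \<Rightarrow> complex ^ 'e \<Rightarrow> complex" where
  "I T lam \<equiv> tree_integral G \<delta> x\<^sub>0 \<alpha> T lam"

text \<open>These moments arise in the derivative of \<open>I\<close>. For \<open>e\<close> off
  \<open>T\<close>, \<open>raised_integral_recurrence\<close> reduces them to tree integrals, up to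
  the linear form of the cycle.\<close>

definition raised_integral :: "'e set \<Rightarrow> 'e \<Rightarrow> complex ^ 'e \<Rightarrow> complex" where
  "raised_integral T e lam = (\<integral>z. of_real (z $ e) * log_weight lam (tree_exponent \<alpha> T) z \<partial>flow_measure T)"

lemma log_weight_integrable:
  "T \<in> spanning_trees G \<Longrightarrow> \<forall>e. Re (lam $ e) > 0 \<Longrightarrow>
    integrable (flow_measure T) (log_weight lam (tree_exponent \<alpha> T))"
  using well_defined[of T lam] by (simp add: tree_integral_exists_iff)

lemma laplace_hyps:
  assumes "T \<in> spanning_trees G"
  shows "sets (flow_measure T) = sets borel"
    and "\<And>z e. log_weight 0 (tree_exponent \<alpha> T) z \<noteq> 0 \<Longrightarrow> z $ e \<ge> 0"
    and "\<And>lam. (\<forall>e. Re (lam $ e) > 0) \<Longrightarrow>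
      integrable (flow_measure T) (\<lambda>z. exp (- pairing G lam z) * log_weight 0 (tree_exponent \<alpha> T) z)"
proof -
  show "integrable (flow_measure T) (\<lambda>z. exp (- pairing G lam z) * log_weight 0 (tree_exponent \<alpha> T) z)"
    if "\<forall>e. Re (lam $ e) > 0" for lam
    using log_weight_integrable[OF assms that] by (simp flip: log_weight_split)
qed (auto simp: log_weight_def less_imp_le split: if_splits)

lemma raised_integrable:
  assumes "T \<in> spanning_trees G" "\<forall>e. Re (lam $ e) > 0"
  shows "integrable (flow_measure T) (\<lambda>z. of_real (z $ e) * log_weight lam (tree_exponent \<alpha> T) z)"
  using laplace_moment_integrable[OF laplace_hyps[OF assms(1)] assms(2), of e]
  by (simp flip: log_weight_split)

text \<open>On \<open>C\<close> the raised exponents are \<alpha> itself, as the edges of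
  \<open>C\<close> other than \<open>e\<^sub>0\<close> lie in \<open>T\<close>. Dividing by
  \<open>z $ e\<close> leaves exactly the weight of the tree exchanged at \<open>e\<close>, so every
  term of the integration by parts is a tree integral.\<close>

lemma raised_integral_recurrence:
  assumes T: "T \<in> spanning_trees G" and lam: "\<forall>e. Re (lam $ e) > 0" and e\<^sub>0: "e\<^sub>0 \<notin> T"
    and C: "simple_cycle G C" "C \<subseteq> insert e\<^sub>0 T" and s: "cycle_orientation G C s"
  shows "signed_form s C lam * raised_integral T e\<^sub>0 lam =
    (\<Sum>e\<in>C. of_real (s e * \<alpha> e) * I (insert e\<^sub>0 T - {e}) lam)"
proof -
  let ?c = "fundamental_flow T e\<^sub>0"
  define \<beta> where "\<beta> = (tree_exponent \<alpha> T)(e\<^sub>0 := tree_exponent \<alpha> T e\<^sub>0 + 1)"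
  have \<beta>_C: "\<beta> e = \<alpha> e" if "e \<in> C" for e
    using that C(2) e\<^sub>0 by (auto simp: \<beta>_def tree_exponent_def)
  have e\<^sub>0C: "e\<^sub>0 \<in> C" using tree_acyclic[OF T C(1)] C(2) by auto
  note c = fundamental_flow_cycle_nth[OF T e\<^sub>0 C s]
  have s1: "s e \<noteq> 0" if "e \<in> C" for e using cycle_orientation_sign[OF s that] by auto
  have S: "{e. ?c $ e \<noteq> 0} = C" using s1 e\<^sub>0C by (auto simp: c)
  have div: "log_weight lam \<beta> z / of_real (z $ e) = log_weight lam (tree_exponent \<alpha> (insert e\<^sub>0 T - {e})) z"
    if e: "e \<in> C" for e z
  proof -
    let ?\<gamma> = "tree_exponent \<alpha> (insert e\<^sub>0 T - {e})"
    have "\<beta> = ?\<gamma>(e := ?\<gamma> e + 1)"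
      using e C(2) e\<^sub>0 by (auto simp: \<beta>_def tree_exponent_def fun_eq_iff)
    then have "log_weight lam \<beta> z = of_real (z $ e) * log_weight lam ?\<gamma> z"
      by (metis log_weight_raise)
    \<comment> \<open>Where \<open>z $ e = 0\<close> both weights vanish, in agreement with division
      by 0.\<close>
    then show ?thesis by (cases "z $ e = 0") (auto simp: log_weight_def intro!: exI[of _ e])
  qed
  have T': "insert e\<^sub>0 T - {e} \<in> spanning_trees G" and \<mu>: "flow_measure (insert e\<^sub>0 T - {e}) = flow_measure T" if "e \<in> C" for e
    using exchange_spanning_tree[OF T C that] flow_measure_exchange[OF T e\<^sub>0 C that] by auto
  have g: "log_weight lam \<beta> = (\<lambda>z. of_real (z $ e\<^sub>0) * log_weight lam (tree_exponent \<alpha> T) z)"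
    by (simp add: \<beta>_def log_weight_raise fun_eq_iff)
  have "(\<Sum>e\<in>C. of_real (?c $ e * \<beta> e) * (\<integral>z. log_weight lam \<beta> z / of_real (z $ e) \<partial>flow_measure T)) =
      pairing G lam ?c * (\<integral>z. log_weight lam \<beta> z \<partial>flow_measure T)"
    unfolding S[symmetric]
  proof (rule flow_measure_derivative[OF T e\<^sub>0])
    show "integrable (flow_measure T) (log_weight lam \<beta>)"
      unfolding g by (rule raised_integrable[OF T lam])
    show "integrable (flow_measure T) (\<lambda>z. log_weight lam \<beta> z / of_real (z $ e))" if "?c $ e \<noteq> 0" for e
    proof -
      have e: "e \<in> C" using that S by auto
      show ?thesis using log_weight_integrable[OF T'[OF e] lam] by (simp add: div[OF e] \<mu>[OF e])
    qed
  qed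
  moreover have "(\<integral>z. log_weight lam \<beta> z / of_real (z $ e) \<partial>flow_measure T) = I (insert e\<^sub>0 T - {e}) lam"
    if "e \<in> C" for e
    by (simp add: tree_integral_eq[OF T'[OF that]] div[OF that] \<mu>[OF that])
  moreover have "pairing G lam ?c = of_real (s e\<^sub>0) * signed_form s C lam"
    by (simp add: fundamental_flow_eq[OF T e\<^sub>0 C s] pairing_scaleR pairing_signed_vec)
  moreover have "(\<integral>z. log_weight lam \<beta> z \<partial>flow_measure T) = raised_integral T e\<^sub>0 lam"
    by (simp add: g raised_integral_def)
  ultimately have "(\<Sum>e\<in>C. of_real (s e\<^sub>0) * (of_real (s e * \<alpha> e) * I (insert e\<^sub>0 T - {e}) lam)) =
      of_real (s e\<^sub>0) * (signed_form s C lam * raised_integral T e\<^sub>0 lam)"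
    by (simp add: c \<beta>_C mult.assoc)
  then show ?thesis
    using s1[OF e\<^sub>0C] by (simp flip: sum_distrib_left)
qed

lemma tree_integral_has_derivative:
  assumes T: "T \<in> spanning_trees G" and lam: "\<forall>e. Re (lam $ e) > 0"
  shows "(I T has_derivative (\<lambda>h. - (pairing G h (tree_flow T) * I T lam +
    (\<Sum>e\<in>- T. pairing G h (fundamental_flow T e) * raised_integral T e lam)))) (at lam)"
proof -
  let ?w = "log_weight lam (tree_exponent \<alpha> T)"
  have "(\<integral>z. pairing G h z * ?w z \<partial>flow_measure T) = pairing G h (tree_flow T) * I T lam +
      (\<Sum>e\<in>- T. pairing G h (fundamental_flow T e) * raised_integral T e lam)" for h
  proof -
    let ?r = "\<lambda>z. pairing G h (tree_flow T) * ?w z +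
      (\<Sum>e\<in>- T. pairing G h (fundamental_flow T e) * (of_real (z $ e) * ?w z))"
    \<comment> \<open>The expansion of the pairing holds for unit flows only, so the integral goes
      back to the chart, is rewritten there and returns.\<close>
    have "(\<integral>z. pairing G h z * ?w z \<partial>flow_measure T) =
        (\<integral>y. pairing G h (flow_section T y) * ?w (flow_section T y) \<partial>Pi\<^sub>M (- T) (\<lambda>_. lborel))"
      unfolding flow_measure_def by (intro integral_distr) measurable
    also have "\<dots> = (\<integral>y. ?r (flow_section T y) \<partial>Pi\<^sub>M (- T) (\<lambda>_. lborel))"
    proof (intro Bochner_Integration.integral_cong refl)
      fix y
      have "pairing G h (flow_section T y) = pairing G h (tree_flow T) +
          (\<Sum>e\<in>- T. pairing G h (fundamental_flow T e) * of_real (flow_section T y $ e))"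
        by (simp add: flow_section_nth[OF T])
          (simp add: flow_section_def pairing_add pairing_sum pairing_scaleR mult.commute)
      then show "pairing G h (flow_section T y) * ?w (flow_section T y) = ?r (flow_section T y)"
        by (simp add: distrib_right sum_distrib_right mult.assoc)
    qed
    also have "\<dots> = (\<integral>z. ?r z \<partial>flow_measure T)"
      unfolding flow_measure_def by (intro integral_distr[symmetric]) measurable
    also have "\<dots> = pairing G h (tree_flow T) * I T lam +
        (\<Sum>e\<in>- T. pairing G h (fundamental_flow T e) * raised_integral T e lam)"
      using log_weight_integrable[OF T lam] raised_integrable[OF T lam]
      by (simp add: tree_integral_eq[OF T] raised_integral_def)
    finally show ?thesis .
  qed
  moreover have "I T = (\<lambda>lam. \<integral>z. exp (- pairing G lam z) * log_weight 0 (tree_exponent \<alpha> T) z \<partial>flow_measure T)"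
    by (simp add: fun_eq_iff tree_integral_eq[OF T] flip: log_weight_split)
  ultimately show ?thesis
    using laplace_has_derivative[OF laplace_hyps[OF T] lam] by (simp flip: log_weight_split)
qed

lemma path_sum:
  assumes T: "T \<in> spanning_trees G"
  shows "(\<Sum>\<sigma>\<in>{\<sigma>. simple_path G x\<^sub>0 \<delta> \<sigma>}. path_form G \<delta> x\<^sub>0 \<sigma> h * of_real (path_matrix \<sigma> T T')) =
    (if T' = T then pairing G h (tree_flow T) else 0)"
proof -
  obtain \<tau> where \<tau>: "simple_path G x\<^sub>0 \<delta> \<tau>" "\<tau> \<subseteq> T" using tree_path_exists[OF T] by blast
  have unique: "\<sigma> = \<tau>" if \<sigma>: "simple_path G x\<^sub>0 \<delta> \<sigma>" "\<sigma> \<subseteq> T" for \<sigma>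
  proof -
    \<comment> \<open>Signs are \<plusminus>1, so a path is the support of its signed vector, which
      \<open>tree_flow\<close> determines.\<close>
    have supp: "{e. signed_vec (path_sign G x\<^sub>0 \<delta> \<rho>) \<rho> $ e \<noteq> 0} = \<rho>" for \<rho> by (auto simp: path_sign_def)
    have "signed_vec (path_sign G x\<^sub>0 \<delta> \<sigma>) \<sigma> = signed_vec (path_sign G x\<^sub>0 \<delta> \<tau>) \<tau>"
      using tree_flow_eq[OF T \<sigma>] tree_flow_eq[OF T \<tau>] by simp
    then show ?thesis by (subst supp[symmetric], subst (2) supp[symmetric]) (simp only:)
  qed
  have "(\<Sum>\<sigma>\<in>{\<sigma>. simple_path G x\<^sub>0 \<delta> \<sigma>}. path_form G \<delta> x\<^sub>0 \<sigma> h * of_real (path_matrix \<sigma> T T')) =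
      (\<Sum>\<sigma>\<in>{\<sigma>. simple_path G x\<^sub>0 \<delta> \<sigma>}. if \<sigma> = \<tau> then if T' = T then path_form G \<delta> x\<^sub>0 \<tau> h else 0 else 0)"
    using \<tau> by (intro sum.cong refl) (auto simp: path_matrix_def dest: unique)
  then show ?thesis
    using \<tau> by (simp add: tree_flow_eq[OF T \<tau>] pairing_signed_vec path_form_def)
qed

text \<open>Row \<open>T\<close> of a cycle matrix can be nonzero only for a fundamental cycle of
  \<open>T\<close>, and these are indexed injectively by the edges off \<open>T\<close>. For each of
  them the recurrence produces the factor that cancels the denominator.\<close>

lemma cycle_sum:
  assumes T: "T \<in> spanning_trees G" and lam: "\<forall>e. Re (lam $ e) > 0" and reg: "lam \<in> regular_points G \<epsilon>"
    and \<epsilon>: "\<And>C. simple_cycle G C \<Longrightarrow> cycle_orientation G C (\<epsilon> C)"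
  shows "(\<Sum>T'\<in>spanning_trees G. (\<Sum>C\<in>{C. simple_cycle G C}.
      cycle_form \<epsilon> C h / cycle_form \<epsilon> C lam * of_real (cycle_matrix G \<alpha> \<epsilon> C T T')) * I T' lam) =
    (\<Sum>e\<in>- T. pairing G h (fundamental_flow T e) * raised_integral T e lam)"
proof -
  define f where "f C = cycle_form \<epsilon> C h / cycle_form \<epsilon> C lam *
    (\<Sum>T'\<in>spanning_trees G. of_real (cycle_matrix G \<alpha> \<epsilon> C T T') * I T' lam)" for C
  have "\<exists>C. simple_cycle G C \<and> C \<subseteq> insert e T" if "e \<in> - T" for e
    using fundamental_cycle_exists[OF T] that by blast
  then obtain cyc where cyc: "\<And>e. e \<in> - T \<Longrightarrow> simple_cycle G (cyc e) \<and> cyc e \<subseteq> insert e T"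
    by metis
  have base: "e \<in> C" if "simple_cycle G C" "C \<subseteq> insert e T" for e C
    using tree_acyclic[OF T that(1)] that(2) by auto
  have inj: "inj_on cyc (- T)"
    by (rule inj_onI) (metis ComplD base cyc insertE subsetD)
  have f_cyc: "f (cyc e\<^sub>0) = pairing G h (fundamental_flow T e\<^sub>0) * raised_integral T e\<^sub>0 lam"
    if "e\<^sub>0 \<in> - T" for e\<^sub>0
  proof -
    let ?C = "cyc e\<^sub>0"
    have e\<^sub>0: "e\<^sub>0 \<notin> T" and C: "simple_cycle G ?C" "?C \<subseteq> insert e\<^sub>0 T" using that cyc by auto
    note s = \<epsilon>[OF C(1)]
    have e\<^sub>0C: "e\<^sub>0 \<in> ?C" using base[OF C] .
    have the: "(THE e. e \<in> arcs G - T \<and> ?C \<subseteq> T \<union> {e}) = e\<^sub>0"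
      using e\<^sub>0 C(2) e\<^sub>0C by (intro the_equality) auto
    have "\<exists>e\<in>arcs G - T. ?C \<subseteq> T \<union> {e}" using e\<^sub>0 C(2) by (intro bexI[of _ e\<^sub>0]) auto
    note ex = this
    \<comment> \<open>Comparing signs is multiplying them. This isolates the factor
      \<open>\<epsilon> ?C e\<^sub>0\<close>, which the fundamental flow carries too.\<close>
    have sgn: "(if \<epsilon> ?C e\<^sub>0 = \<epsilon> ?C e then 1 else - 1) = \<epsilon> ?C e\<^sub>0 * \<epsilon> ?C e" if "e \<in> ?C" for e
      using cycle_orientation_sign[OF s e\<^sub>0C] cycle_orientation_sign[OF s that] by auto
    have m: "cycle_matrix G \<alpha> \<epsilon> ?C T T' =
        (\<Sum>e\<in>?C. \<epsilon> ?C e\<^sub>0 * (\<epsilon> ?C e * \<alpha> e) * tree_basis (insert e\<^sub>0 T - {e}) T')" for T'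
      unfolding cycle_matrix_def cycle_endo_basis_def if_P[OF ex] Let_def the
      by (intro sum.cong refl) (simp add: sgn mult.assoc)
    have "(\<Sum>T'\<in>spanning_trees G. of_real (cycle_matrix G \<alpha> \<epsilon> ?C T T') * I T' lam) =
        (\<Sum>e\<in>?C. \<Sum>T'\<in>spanning_trees G. of_real (\<epsilon> ?C e\<^sub>0 * (\<epsilon> ?C e * \<alpha> e) * tree_basis (insert e\<^sub>0 T - {e}) T') * I T' lam)"
      unfolding m of_real_sum sum_distrib_right by (rule sum.swap)
    also have "\<dots> = (\<Sum>e\<in>?C. of_real (\<epsilon> ?C e\<^sub>0) * (of_real (\<epsilon> ?C e * \<alpha> e) * I (insert e\<^sub>0 T - {e}) lam))"
    proof (intro sum.cong refl)
      fix e assume "e \<in> ?C"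
      then have "insert e\<^sub>0 T - {e} \<in> spanning_trees G" using exchange_spanning_tree[OF T C] by blast
      moreover have "(\<Sum>T'\<in>spanning_trees G. of_real (\<epsilon> ?C e\<^sub>0 * (\<epsilon> ?C e * \<alpha> e) * tree_basis (insert e\<^sub>0 T - {e}) T') * I T' lam) =
          (\<Sum>T'\<in>spanning_trees G. if T' = insert e\<^sub>0 T - {e} then
            of_real (\<epsilon> ?C e\<^sub>0) * (of_real (\<epsilon> ?C e * \<alpha> e) * I (insert e\<^sub>0 T - {e}) lam) else 0)"
        by (intro sum.cong) (auto simp: tree_basis_def)
      ultimately show "(\<Sum>T'\<in>spanning_trees G. of_real (\<epsilon> ?C e\<^sub>0 * (\<epsilon> ?C e * \<alpha> e) * tree_basis (insert e\<^sub>0 T - {e}) T') * I T' lam) =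
          of_real (\<epsilon> ?C e\<^sub>0) * (of_real (\<epsilon> ?C e * \<alpha> e) * I (insert e\<^sub>0 T - {e}) lam)"
        by simp
    qed
    also have "\<dots> = of_real (\<epsilon> ?C e\<^sub>0) * (cycle_form \<epsilon> ?C lam * raised_integral T e\<^sub>0 lam)"
      unfolding cycle_form_def raised_integral_recurrence[OF T lam e\<^sub>0 C s] by (simp add: sum_distrib_left)
    finally have "f ?C = cycle_form \<epsilon> ?C h / cycle_form \<epsilon> ?C lam *
        (of_real (\<epsilon> ?C e\<^sub>0) * (cycle_form \<epsilon> ?C lam * raised_integral T e\<^sub>0 lam))"
      by (simp add: f_def)
    \<comment> \<open>Here \<open>lam\<close> must avoid the kernels of the cycle forms.\<close>
    moreover have "cycle_form \<epsilon> ?C lam \<noteq> 0" using reg C by (auto simp: regular_points_def)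
    moreover have "pairing G h (fundamental_flow T e\<^sub>0) = of_real (\<epsilon> ?C e\<^sub>0) * cycle_form \<epsilon> ?C h"
      by (simp add: fundamental_flow_eq[OF T e\<^sub>0 C s] pairing_scaleR pairing_signed_vec cycle_form_def)
    ultimately show ?thesis by simp
  qed
  have "(\<Sum>T'\<in>spanning_trees G. (\<Sum>C\<in>{C. simple_cycle G C}.
      cycle_form \<epsilon> C h / cycle_form \<epsilon> C lam * of_real (cycle_matrix G \<alpha> \<epsilon> C T T')) * I T' lam) =
    (\<Sum>C\<in>{C. simple_cycle G C}. f C)"
    unfolding f_def sum_distrib_right sum_distrib_left mult.assoc by (rule sum.swap)
  also have "\<dots> = (\<Sum>C\<in>cyc ` (- T). f C)"
  proof (rule sum.mono_neutral_right)
    show "\<forall>C\<in>{C. simple_cycle G C} - cyc ` (- T). f C = 0"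
    proof
      fix C assume C: "C \<in> {C. simple_cycle G C} - cyc ` (- T)"
      have "\<not> (\<exists>e\<in>arcs G - T. C \<subseteq> T \<union> {e})"
      proof
        assume "\<exists>e\<in>arcs G - T. C \<subseteq> T \<union> {e}"
        then obtain e where e: "e \<in> - T" "C \<subseteq> insert e T" by auto
        then have "C = cyc e"
          using C cyc[OF e(1)] by (intro fundamental_cycle_unique[OF T]) auto
        then show False using C e(1) by auto
      qed
      then have "cycle_matrix G \<alpha> \<epsilon> C T T' = 0" for T'
        unfolding cycle_matrix_def cycle_endo_basis_def by simp
      then show "f C = 0" by (simp add: f_def)
    qed
  qed (use cyc in auto)
  also have "\<dots> = (\<Sum>e\<in>- T. pairing G h (fundamental_flow T e) * raised_integral T e lam)"
    by (simp add: sum.reindex[OF inj] f_cyc)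
  finally show ?thesis .
qed

text \<open>The forms of paths and cycles are linear, so their differentials at \<open>lam\<close>
  are the forms themselves, evaluated at \<open>h\<close>.\<close>

lemma connection_sum:
  assumes T: "T \<in> spanning_trees G" and lam: "\<forall>e. Re (lam $ e) > 0" and reg: "lam \<in> regular_points G \<epsilon>"
    and \<epsilon>: "\<And>C. simple_cycle G C \<Longrightarrow> cycle_orientation G C (\<epsilon> C)"
  shows "(\<Sum>T'\<in>spanning_trees G. connection_form G \<delta> x\<^sub>0 \<alpha> \<epsilon> T T' lam h * I T' lam) =
    pairing G h (tree_flow T) * I T lam +
    (\<Sum>e\<in>- T. pairing G h (fundamental_flow T e) * raised_integral T e lam)"
proof -
  have "(\<Sum>T'\<in>spanning_trees G. (if T' = T then pairing G h (tree_flow T) else 0) * I T' lam) =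
      pairing G h (tree_flow T) * I T lam"
    using T by (simp add: if_distrib[of "\<lambda>x. x * _"] cong: if_cong)
  moreover have "connection_form G \<delta> x\<^sub>0 \<alpha> \<epsilon> T T' lam h = (if T' = T then pairing G h (tree_flow T) else 0) +
      (\<Sum>C\<in>{C. simple_cycle G C}.
        cycle_form \<epsilon> C h / cycle_form \<epsilon> C lam * of_real (cycle_matrix G \<alpha> \<epsilon> C T T'))" for T'
    unfolding connection_form_def path_sum[OF T, symmetric]
    by (simp add: cycle_form_def path_form_def frechet_derivative_signed_form)
  moreover have "(\<Sum>T'\<in>spanning_trees G. (\<Sum>C\<in>{C. simple_cycle G C}.
      cycle_form \<epsilon> C h / cycle_form \<epsilon> C lam * of_real (cycle_matrix G \<alpha> \<epsilon> C T T')) * I T' lam) =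
    (\<Sum>e\<in>- T. pairing G h (fundamental_flow T e) * raised_integral T e lam)"
    by (rule cycle_sum[OF T lam reg]) (rule \<epsilon>)
  ultimately show ?thesis
    by (simp only: distrib_right sum.distrib)
qed

end

end

theorem theorem3p1:
  fixes G :: "('v, 'e::finite) pre_digraph"
    and \<delta> x\<^sub>0 :: 'v
    and \<alpha> :: "'e \<Rightarrow> real"
    and \<epsilon> :: "'e set \<Rightarrow> 'e \<Rightarrow> real"
  assumes graph: "cemetery_digraph G \<delta> x\<^sub>0"
    and orientations: "\<And>C. simple_cycle G C \<Longrightarrow> cycle_orientation G C (\<epsilon> C)"
    and well_defined:
      "\<And>T (lam :: complex ^ 'e). T \<in> spanning_trees G \<Longrightarrow> (\<forall>e\<in>arcs G. Re (lam $ e) > 0) \<Longrightarrow>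
         tree_integral_exists G \<delta> x\<^sub>0 \<alpha> T lam"
  shows "\<forall>lam \<in> regular_points G \<epsilon> \<inter> {lam. \<forall>e\<in>arcs G. Re (lam $ e) > 0}. \<forall>T\<in>spanning_trees G.
           (tree_integral G \<delta> x\<^sub>0 \<alpha> T has_derivative
              (\<lambda>h. - (\<Sum>T'\<in>spanning_trees G.
                        connection_form G \<delta> x\<^sub>0 \<alpha> \<epsilon> T T' lam h * tree_integral G \<delta> x\<^sub>0 \<alpha> T' lam)))
           (at lam)"
proof (intro ballI)
  interpret cemetery_digraph G \<delta> x\<^sub>0 by (rule graph)
  fix lam T assume "lam \<in> regular_points G \<epsilon> \<inter> {lam. \<forall>e\<in>arcs G. Re (lam $ e) > 0}" and T: "T \<in> spanning_trees G"
  then have lam: "\<forall>e. Re (lam $ e) > 0" and reg: "lam \<in> regular_points G \<epsilon>" by auto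
  have sum: "(\<Sum>T'\<in>spanning_trees G.
        connection_form G \<delta> x\<^sub>0 \<alpha> \<epsilon> T T' lam h * tree_integral G \<delta> x\<^sub>0 \<alpha> T' lam) =
      pairing G h (tree_flow T) * tree_integral G \<delta> x\<^sub>0 \<alpha> T lam +
      (\<Sum>e\<in>- T. pairing G h (fundamental_flow T e) * raised_integral \<alpha> T e lam)" for h
    by (rule connection_sum[OF _ T lam reg]) (auto intro: well_defined orientations)
  show "(tree_integral G \<delta> x\<^sub>0 \<alpha> T has_derivative
      (\<lambda>h. - (\<Sum>T'\<in>spanning_trees G.
        connection_form G \<delta> x\<^sub>0 \<alpha> \<epsilon> T T' lam h * tree_integral G \<delta> x\<^sub>0 \<alpha> T' lam))) (at lam)"
    unfolding sum by (rule tree_integral_has_derivative[OF _ T lam]) (rule well_defined)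
qed

end
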